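(* Let $R$ be an orthogonal operator on $\mathbb{R}^d$ and let $z \in \mathbb{R}^d$ be a unit vector. Let $\Theta$ be the orthogonal complement of $z$ in $\mathbb{R}^d$ and $P$ the orthogonal projection on $\Theta$. Let $\sigma(R) \subset \{-1, 1\}$ be the real spectrum of $R$, for $\lambda \in \sigma(R)$ put $W_\lambda := \operatorname{Ker}(R - \lambda\mathbb{I})$, and let $A_1, \ldots, A_k$, where $k \le d/2$, denote the invariant planes of $R$, which together with the eigenspaces $W_\lambda$, $\lambda \in \sigma(R)$, constitute an orthogonal decomposition of $\mathbb{R}^d$. Then $$\sum_{n=0}^{\infty} \|(PR)^n z\|^2 = d - \sum_{\lambda \in \sigma(R)} \dim(\Theta \cap W_\lambda) - 2|K|,$$ where $K := \{ j = 1, \ldots, k : A_j \subset \Theta \}$.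
   Context: $\mathbb{R}^d$ carries the standard inner product and Euclidean norm. That $A_j$ ($j = 1, \ldots, k$) is an invariant plane of $R$ means that $A_j$ is a two-dimensional subspace of $\mathbb{R}^d$ with the property that there exists $\varphi_j \in \mathbb{R}$ such that, with respect to every orthonormal basis of $A_j$, the restriction $R|_{A_j}$ has the matrix $\begin{bmatrix} \cos\varphi_j & \pm\sin\varphi_j \\ \mp\sin\varphi_j & \cos\varphi_j \end{bmatrix}$, with the sign depending on the orientation of the basis. An orthogonal decomposition of $\mathbb{R}^d$ means that the listed subspaces are pairwise orthogonal and their direct sum is $\mathbb{R}^d$. The zeroth power of any operator is the identity.
   Formalization: The formula fails for some choices of invariant planes when rotation angles repeat, so it is stated for decompositions where, among planes sharing an angle, at most one is not contained in Θ; such a decomposition is proved to exist for every R and z. *)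

theory Defs
  imports "HOL-Analysis.Analysis"
begin

definition orth_proj :: "('a::euclidean_space) set \<Rightarrow> 'a \<Rightarrow> 'a" where
  "orth_proj S x = (THE y. y \<in> S \<and> x - y \<in> S\<^sup>\<bottom>)"

lemma orth_proj_unique:
  fixes S :: "'a::euclidean_space set"
  assumes "subspace S" "y \<in> S" "x - y \<in> S\<^sup>\<bottom>"
  shows "orth_proj S x = y"
  unfolding orth_proj_def
proof (rule the_equality)
  fix w assume w: "w \<in> S \<and> x - w \<in> S\<^sup>\<bottom>"
  have "(x - y) - (x - w) \<in> S\<^sup>\<bottom>"
    using w assms(3) subspace_diff[OF subspace_orthogonal_comp] by blast
  moreover have "w - y \<in> S"
    using w assms subspace_diff by blast
  ultimately have "(w - y) \<bullet> (w - y) = 0"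
    by (auto simp: orthogonal_comp_def orthogonal_def)
  then show "w = y" by simp
qed (use assms in auto)

lemma orth_proj_props:
  fixes S :: "'a::euclidean_space set"
  assumes "subspace S"
  shows "orth_proj S x \<in> S" "x - orth_proj S x \<in> S\<^sup>\<bottom>"
proof -
  obtain y w where "y \<in> S" "w \<in> S\<^sup>\<bottom>" "x = y + w"
    using subspace_sum_orthogonal_comp[OF assms] by (metis UNIV_I set_plus_elim)
  then show "orth_proj S x \<in> S" "x - orth_proj S x \<in> S\<^sup>\<bottom>"
    using orth_proj_unique[OF assms, of y x] by auto
qed

definition eigenspace :: "('a::real_vector \<Rightarrow> 'a) \<Rightarrow> real \<Rightarrow> 'a set" where
  "eigenspace R \<mu> = {x. R x - \<mu> *\<^sub>R x = 0}"

definition real_spectrum :: "('a::real_vector \<Rightarrow> 'a) \<Rightarrow> real set" where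
  "real_spectrum R = {\<mu>. eigenspace R \<mu> \<noteq> {0}}"

definition orthonormal_basis2 :: "('a::euclidean_space) set \<Rightarrow> 'a \<Rightarrow> 'a \<Rightarrow> bool" where
  "orthonormal_basis2 A u v \<longleftrightarrow> norm u = 1 \<and> norm v = 1 \<and> orthogonal u v \<and> span {u, v} = A"

(* The two disjuncts are the columns of the matrices
     [[cos \<phi>, sin \<phi>], [-sin \<phi>, cos \<phi>]]  and  [[cos \<phi>, -sin \<phi>], [sin \<phi>, cos \<phi>]].
   Interchanging u and v interchanges the disjuncts; thus the sign follows the orientation of
   the basis, and \<phi> and -\<phi> are angles of the same plane. *)
definition rotates_plane_by :: "('a::euclidean_space \<Rightarrow> 'a) \<Rightarrow> 'a set \<Rightarrow> real \<Rightarrow> bool" where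
  "rotates_plane_by R A \<phi> \<longleftrightarrow> subspace A \<and> dim A = 2 \<and>
     (\<forall>u v. orthonormal_basis2 A u v \<longrightarrow>
        (R u = cos \<phi> *\<^sub>R u - sin \<phi> *\<^sub>R v \<and> R v = sin \<phi> *\<^sub>R u + cos \<phi> *\<^sub>R v) \<or>
        (R u = cos \<phi> *\<^sub>R u + sin \<phi> *\<^sub>R v \<and> R v = - sin \<phi> *\<^sub>R u + cos \<phi> *\<^sub>R v))"

definition invariant_plane :: "('a::euclidean_space \<Rightarrow> 'a) \<Rightarrow> 'a set \<Rightarrow> bool" where
  "invariant_plane R A \<longleftrightarrow> (\<exists>\<phi>. rotates_plane_by R A \<phi>)"

definition orthogonal_decomposition :: "'i set \<Rightarrow> ('i \<Rightarrow> ('a::euclidean_space) set) \<Rightarrow> bool" where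
  "orthogonal_decomposition I S \<longleftrightarrow> finite I \<and> (\<forall>i\<in>I. subspace (S i)) \<and>
     (\<forall>i\<in>I. \<forall>j\<in>I. i \<noteq> j \<longrightarrow> (\<forall>x\<in>S i. \<forall>y\<in>S j. orthogonal x y)) \<and>
     (\<forall>x. \<exists>!f. f \<in> (\<Pi>\<^sub>E i\<in>I. S i) \<and> x = (\<Sum>i\<in>I. f i))"

definition invariant_plane_decomposition ::
    "('a::euclidean_space \<Rightarrow> 'a) \<Rightarrow> nat \<Rightarrow> (nat \<Rightarrow> 'a set) \<Rightarrow> bool" where
  "invariant_plane_decomposition R k A \<longleftrightarrow> real k \<le> real DIM('a) / 2 \<and>
     (\<forall>j\<in>{1..k}. invariant_plane R (A j)) \<and>
     orthogonal_decomposition (Inl ` real_spectrum R \<union> Inr ` {1..k}) (case_sum (eigenspace R) A)"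

(* If several planes share a rotation angle, an orthogonal decomposition into invariant planes
   is not unique, and the number of planes contained in \<Theta> depends on the choice: for
   multiplication by the imaginary unit on C^2 = R^4 and \<Theta> the complement of (1,1)/sqrt 2,
   the two coordinate planes are not contained in \<Theta>, while in the decomposition into the
   complex spans of (1,1) and (1,-1) the second plane is.  An adapted decomposition is one in
   which at most one of the planes sharing an angle is not contained in \<Theta>.  When no two of the
   planes share an angle, every decomposition is adapted, whatever \<Theta> is. *)
definition adapted_planes ::
    "('a::euclidean_space \<Rightarrow> 'a) \<Rightarrow> 'a set \<Rightarrow> nat \<Rightarrow> (nat \<Rightarrow> 'a set) \<Rightarrow> bool" where
  "adapted_planes R \<Theta> k A \<longleftrightarrow>
     (\<forall>i\<in>{1..k}. \<forall>j\<in>{1..k}. \<forall>\<phi>. i \<noteq> j \<and> rotates_plane_by R (A i) \<phi> \<and> rotates_plane_by R (A j) \<phi>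
        \<longrightarrow> A i \<subseteq> \<Theta> \<or> A j \<subseteq> \<Theta>)"

end

theory Submission
  imports Defs
begin

text \<open>Let \<open>U\<close> (\<open>core \<Theta>\<close> below) be the largest \<open>R\<close>-invariant subspace contained in \<open>\<Theta>\<close>. The adjoint
  \<open>T\<close> of \<open>P R\<close> is \<open>R\<inverse> P\<close> and satisfies \<open>\<parallel>T x\<parallel>\<^sup>2 = \<parallel>x\<parallel>\<^sup>2 - \<langle>x, z\<rangle>\<^sup>2\<close>. Expanding \<open>(P R)\<^sup>n z\<close> in an
  orthonormal basis adapted to \<open>U\<close> and its complement, the partial sums telescope to
  \<open>\<Sum>\<^sub>b (\<parallel>b\<parallel>\<^sup>2 - \<parallel>T\<^sup>N b\<parallel>\<^sup>2)\<close>. As \<open>T\<close> is isometric on \<open>U\<close> and its powers tend to \<open>0\<close> on the complement,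
  the series converges to \<open>d - dim U\<close>.

  The self-adjoint operator \<open>R + R\<inverse>\<close> is \<open>2 \<lambda>\<close> on \<open>W\<^sub>\<lambda>\<close> and \<open>2 cos \<phi>\<close> on a plane of angle \<open>\<phi>\<close>. For an
  adapted decomposition these numbers are distinct on the components that are not planes inside
  \<open>\<Theta>\<close>, so \<open>U\<close> is the sum of its intersections with the components. An adapted decomposition
  arises by splitting the parts of \<open>U\<close> and of its complement orthogonal to all eigenvectors separately into planes.\<close>

section \<open>Orthogonal families of subspaces\<close>

lemma dim_span_orthogonal_family:
  fixes S :: "'i \<Rightarrow> 'a::euclidean_space set"
  assumes "finite I"
    and "\<And>i j x y. i \<in> I \<Longrightarrow> j \<in> I \<Longrightarrow> i \<noteq> j \<Longrightarrow> x \<in> S i \<Longrightarrow> y \<in> S j \<Longrightarrow> orthogonal x y"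
  shows "dim (span (\<Union>i\<in>I. S i)) = (\<Sum>i\<in>I. dim (S i))"
  using assms
proof (induction I rule: finite_induct)
  case (insert a F)
  have "dim (S a \<union> (\<Union>i\<in>F. S i)) = dim (S a) + dim (\<Union>i\<in>F. S i)"
  proof (rule dim_orthogonal_sum)
    fix x y assume "x \<in> S a" "y \<in> (\<Union>i\<in>F. S i)"
    then obtain j where "j \<in> F" "y \<in> S j" by blast
    moreover from this have "a \<noteq> j" using insert by blast
    ultimately show "x \<bullet> y = 0"
      using insert.prems[of a j x y] \<open>x \<in> S a\<close> by (simp add: orthogonal_def)
  qed
  moreover have "dim (span (\<Union>i\<in>F. S i)) = (\<Sum>i\<in>F. dim (S i))"
    by (rule insert.IH) (use insert.prems in blast)
  ultimately show ?case using insert by simp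
qed simp

lemma span_UN_subspaces:
  fixes S :: "'i \<Rightarrow> 'a::real_vector set"
  assumes "finite I" "\<And>i. i \<in> I \<Longrightarrow> subspace (S i)" "x \<in> span (\<Union>i\<in>I. S i)"
  shows "\<exists>f. (\<forall>i\<in>I. f i \<in> S i) \<and> x = (\<Sum>i\<in>I. f i)"
  using assms(3)
proof (induction x rule: span_induct_alt)
  case base
  show ?case by (rule exI[of _ "\<lambda>_. 0"]) (use assms(2) in \<open>auto simp: subspace_0\<close>)
next
  case (step c x y)
  then obtain f where f: "\<forall>i\<in>I. f i \<in> S i" "y = (\<Sum>i\<in>I. f i)" by blast
  from step obtain a where a: "a \<in> I" "x \<in> S a" by blast
  let ?g = "\<lambda>i. (if i = a then c *\<^sub>R x else 0) + f i"
  have "(\<Sum>i\<in>I. ?g i) = c *\<^sub>R x + y"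
    using a assms(1) f by (simp add: sum.distrib)
  moreover have "\<forall>i\<in>I. ?g i \<in> S i"
    using f a assms(2) by (auto intro: subspace_add subspace_scale)
  ultimately show ?case by (intro exI[of _ ?g]) auto
qed

text \<open>Existence of the components comes from the span. For uniqueness, the differences of two
  families of components are pairwise orthogonal and sum to 0, so by Pythagoras each of them
  vanishes; restricting to \<open>I\<close> makes the representing function unique as an extensional
  function.\<close>

lemma orthogonal_decompositionI:
  fixes S :: "'i \<Rightarrow> 'a::euclidean_space set"
  assumes fin: "finite I" and sub: "\<And>i. i \<in> I \<Longrightarrow> subspace (S i)"
    and orth: "\<And>i j x y. i \<in> I \<Longrightarrow> j \<in> I \<Longrightarrow> i \<noteq> j \<Longrightarrow> x \<in> S i \<Longrightarrow> y \<in> S j \<Longrightarrow> orthogonal x y"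
    and span: "span (\<Union>i\<in>I. S i) = UNIV"
  shows "orthogonal_decomposition I S"
  unfolding orthogonal_decomposition_def
proof (intro conjI ballI allI impI)
  fix x :: 'a
  have x: "x \<in> span (\<Union>i\<in>I. S i)" using span by simp
  obtain f where f: "\<forall>i\<in>I. f i \<in> S i" "x = (\<Sum>i\<in>I. f i)"
    using span_UN_subspaces[OF fin sub x] by blast
  show "\<exists>!f. f \<in> (\<Pi>\<^sub>E i\<in>I. S i) \<and> x = (\<Sum>i\<in>I. f i)"
  proof (rule ex1I[of _ "restrict f I"])
    show "restrict f I \<in> (\<Pi>\<^sub>E i\<in>I. S i) \<and> x = (\<Sum>i\<in>I. restrict f I i)"
      using f by auto
  next
    fix g assume g: "g \<in> (\<Pi>\<^sub>E i\<in>I. S i) \<and> x = (\<Sum>i\<in>I. g i)"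
    let ?h = "\<lambda>i. g i - f i"
    have h: "?h i \<in> S i" if "i \<in> I" for i
      using that g f sub by (auto intro: subspace_diff)
    have "(norm (\<Sum>i\<in>I. ?h i))\<^sup>2 = (\<Sum>i\<in>I. (norm (?h i))\<^sup>2)"
      by (rule norm_sum_Pythagorean[OF fin]) (use orth h in \<open>auto simp: pairwise_def\<close>)
    moreover have "(\<Sum>i\<in>I. ?h i) = 0" using g f by (simp add: sum_subtractf)
    ultimately have "\<forall>i\<in>I. (norm (?h i))\<^sup>2 = 0"
      using fin by (simp add: sum_nonneg_eq_0_iff)
    then show "g = restrict f I"
      using g by (intro ext) (auto simp: PiE_def extensional_def)
  qed
qed (use assms in auto)

text \<open>The difference of \<open>x\<close> and its expansion is orthogonal to every element of
  \<open>B\<close>, hence to the whole span, hence to itself, and so is 0. Pythagoras applied to the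
  expansion then gives the identity.\<close>

lemma parseval:
  fixes B :: "'a::euclidean_space set"
  assumes "pairwise orthogonal B" and unit: "\<And>b. b \<in> B \<Longrightarrow> norm b = 1" and "span B = UNIV"
  shows "(norm x)\<^sup>2 = (\<Sum>b\<in>B. (x \<bullet> b)\<^sup>2)"
proof -
  have "0 \<notin> B" using unit by force
  then have fin: "finite B"
    using assms(1) pairwise_orthogonal_independent independent_imp_finite by blast
  have orth: "b \<bullet> c = (if b = c then 1 else 0)" if "b \<in> B" "c \<in> B" for b c
    using that assms(1) unit by (auto simp: pairwise_def orthogonal_def norm_eq_1)
  define y where "y = x - (\<Sum>b\<in>B. (x \<bullet> b) *\<^sub>R b)"
  have "y \<bullet> c = 0" if "c \<in> B" for c
  proof -
    have "(\<Sum>b\<in>B. (x \<bullet> b) * (b \<bullet> c)) = (\<Sum>b\<in>B. if b = c then x \<bullet> b else 0)"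
      by (rule sum.cong) (use orth that in auto)
    then show ?thesis using that fin by (simp add: y_def inner_diff_left inner_sum_left)
  qed
  then have "orthogonal y y"
    using orthogonal_to_span[of y B y] assms(3) by (auto simp: orthogonal_def)
  then have "x = (\<Sum>b\<in>B. (x \<bullet> b) *\<^sub>R b)" by (simp add: y_def orthogonal_self)
  then have "(norm x)\<^sup>2 = (norm (\<Sum>b\<in>B. (x \<bullet> b) *\<^sub>R b))\<^sup>2" by simp
  also have "\<dots> = (\<Sum>b\<in>B. (norm ((x \<bullet> b) *\<^sub>R b))\<^sup>2)"
    by (rule norm_sum_Pythagorean[OF fin])
      (use assms(1) in \<open>auto simp: pairwise_def orthogonal_def\<close>)
  also have "\<dots> = (\<Sum>b\<in>B. (x \<bullet> b)\<^sup>2)"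
    by (rule sum.cong) (use unit in auto)
  finally show ?thesis .
qed

lemma orth_proj_hyperplane:
  assumes "norm z = 1"
  shows "orth_proj ({z}\<^sup>\<bottom>) x = x - (x \<bullet> z) *\<^sub>R z"
  using assms
  by (intro orth_proj_unique subspace_orthogonal_comp)
    (auto simp: orthogonal_comp_def orthogonal_def inner_diff_right inner_commute norm_eq_1)

text \<open>Applying \<open>C\<close> minus \<open>l a\<close> keeps the sum in \<open>U\<close>,
  removes the term of index \<open>a\<close> and multiplies every other term by the nonzero number
  \<open>l i - l a\<close>. By induction these other terms lie in \<open>U\<close>, and the term of
  index \<open>a\<close> remains as a difference of members of \<open>U\<close>.\<close>

lemma subspace_sum_eigenvectors_mem:
  assumes "finite I" "linear C" "subspace U" "\<And>x. x \<in> U \<Longrightarrow> C x \<in> U"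
    and "inj_on l I" "\<And>i. i \<in> I \<Longrightarrow> C (v i) = l i *\<^sub>R v i" "(\<Sum>i\<in>I. v i) \<in> U" "i \<in> I"
  shows "v i \<in> U"
  using assms(1,5-)
proof (induction I arbitrary: v i rule: finite_induct)
  case (insert a F)
  let ?w = "\<lambda>i. (l i - l a) *\<^sub>R v i"
  have "C (\<Sum>i\<in>insert a F. v i) - l a *\<^sub>R (\<Sum>i\<in>insert a F. v i) \<in> U"
    using insert.prems(3) assms(3,4) by (blast intro: subspace_diff subspace_scale)
  also have "C (\<Sum>i\<in>insert a F. v i) = (\<Sum>i\<in>insert a F. C (v i))"
    using linear_sum[OF assms(2)] by blast
  also have "\<dots> = (\<Sum>i\<in>insert a F. l i *\<^sub>R v i)" using insert.prems(2) by (intro sum.cong) auto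
  also have "\<dots> - l a *\<^sub>R (\<Sum>i\<in>insert a F. v i) = (\<Sum>i\<in>F. ?w i)"
    using insert.hyps by (simp add: algebra_simps scaleR_sum_right sum_subtractf)
  finally have w: "(\<Sum>i\<in>F. ?w i) \<in> U" .
  have F: "v j \<in> U" if "j \<in> F" for j
  proof -
    have "?w j \<in> U"
    proof (rule insert.IH)
      show "C (?w i) = l i *\<^sub>R ?w i" if "i \<in> F" for i
        using that insert.prems(2)[of i] by (simp add: linear_cmul[OF assms(2)] mult.commute)
    qed (use insert.prems(1) w that in auto)
    then have "(1 / (l j - l a)) *\<^sub>R ?w j \<in> U" using assms(3) subspace_scale by blast
    moreover have "l j \<noteq> l a"
      using insert.prems(1) insert.hyps that by (metis inj_on_contraD insertCI)
    ultimately show ?thesis by simp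
  qed
  have "(\<Sum>i\<in>insert a F. v i) - (\<Sum>i\<in>F. v i) \<in> U"
    by (rule subspace_diff[OF assms(3) insert.prems(3) subspace_sum[OF assms(3) F]])
  then have "v a \<in> U" using insert.hyps by simp
  then show ?case using F insert.prems(4) by auto
qed simp

text \<open>Injectivity preserves dimension, so in finite dimension the inclusion of the image in
  \<open>E\<close> is an equality. This is how invariance passes between \<open>R\<close> and
  \<open>inv R\<close> in both directions.\<close>

lemma orthogonal_transformation_invariant_image:
  fixes f :: "'a::euclidean_space \<Rightarrow> 'a"
  assumes "orthogonal_transformation f" "subspace E" "\<And>x. x \<in> E \<Longrightarrow> f x \<in> E"
  shows "f ` E = E"
proof (rule subspace_dim_equal)
  have lin: "linear f" using assms(1) by (rule orthogonal_transformation_linear)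
  have "inj f" using assms(1) by (rule orthogonal_transformation_inj)
  then have "dim (f ` E) = dim E"
    by (intro dim_image_eq lin) (auto intro: inj_on_subset)
  then show "dim E \<le> dim (f ` E)" by simp
  show "subspace (f ` E)" using lin assms(2) by (rule linear_subspace_image)
qed (use assms in auto)

section \<open>The largest invariant subspace\<close>

locale orthogonal_operator =
  fixes R :: "'a::euclidean_space \<Rightarrow> 'a"
  assumes orth: "orthogonal_transformation R"
begin

section \<open>Algebra of an orthogonal operator and its inverse\<close>

lemma orth_inv: "orthogonal_transformation (inv R)"
  using orth by (rule orthogonal_transformation_inv)

lemma linear_R: "linear R" and linear_inv: "linear (inv R)"
  using orth orth_inv by (auto intro: orthogonal_transformation_linear)

lemma R_inv [simp]: "R (inv R x) = x" and inv_R [simp]: "inv R (R x) = x"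
  using orth by (simp_all add: orthogonal_transformation_surj surj_f_inv_f
      orthogonal_transformation_inj)

lemma inner_R: "R x \<bullet> R y = x \<bullet> y"
  using orth by (simp add: orthogonal_transformation_def)

lemma norm_R [simp]: "norm (R x) = norm x" and norm_inv [simp]: "norm (inv R x) = norm x"
  using orth orth_inv by (simp_all add: orthogonal_transformation)

lemma inner_inv_right: "x \<bullet> inv R y = R x \<bullet> y"
  using inner_R[of x "inv R y"] by simp

lemma invariant_inv:
  assumes "subspace E" "\<And>x. x \<in> E \<Longrightarrow> R x \<in> E" "x \<in> E"
  shows "inv R x \<in> E"
proof -
  have "x \<in> R ` E" using orthogonal_transformation_invariant_image[OF orth assms(1,2)] assms(3) by simp
  then show ?thesis by auto
qed

text \<open>Moving \<open>R\<close> to the other side of the inner product turns it into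
  \<open>inv R\<close>, which also preserves \<open>E\<close>.\<close>

lemma invariant_orthogonal_comp:
  assumes "subspace E" "\<And>x. x \<in> E \<Longrightarrow> R x \<in> E" "x \<in> E\<^sup>\<bottom>"
  shows "R x \<in> E\<^sup>\<bottom>"
proof -
  have "y \<bullet> R x = 0" if "y \<in> E" for y
  proof -
    have "inv R y \<bullet> x = 0"
      using assms(3) invariant_inv[OF assms(1,2) that]
      by (auto simp: orthogonal_comp_def orthogonal_def)
    then show ?thesis using inner_inv_right[of x y] by (simp add: inner_commute)
  qed
  then show ?thesis by (auto simp: orthogonal_comp_def orthogonal_def)
qed

text \<open>For a subspace \<Theta> this is the largest \<open>R\<close>-invariant subspace
  contained in it. Constraining backward orbits fits the iteration of \<open>adj\<close>, which
  coincides with that of \<open>inv R\<close> as long as the orbit stays in \<Theta>.\<close>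

definition core :: "'a set \<Rightarrow> 'a set" where
  "core \<Theta> = {x. \<forall>n. (inv R ^^ n) x \<in> \<Theta>}"

lemma core_subset: "core \<Theta> \<subseteq> \<Theta>"
  by (auto simp: core_def dest: spec[of _ 0])

lemma linear_funpow_inv: "linear (inv R ^^ n)"
proof (induction n)
  case (Suc n)
  then have "linear (inv R \<circ> inv R ^^ n)" by (rule linear_compose[OF _ linear_inv])
  then show ?case unfolding funpow.simps .
qed (simp add: linear_iff)

lemma subspace_core:
  assumes "subspace \<Theta>"
  shows "subspace (core \<Theta>)"
  using assms unfolding subspace_def core_def
  by (auto simp: linear_funpow_inv linear_0 linear_add linear_cmul)

lemma core_inv: "x \<in> core \<Theta> \<Longrightarrow> inv R x \<in> core \<Theta>"
  by (auto simp: core_def funpow_swap1 dest: spec[of _ "Suc _"])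

text \<open>The definition yields only invariance under \<open>inv R\<close>. As an injective map of
  a finite-dimensional space into itself, \<open>inv R\<close> maps the core onto itself, so
  \<open>R\<close> preserves it too.\<close>

lemma core_R:
  assumes "subspace \<Theta>" "x \<in> core \<Theta>"
  shows "R x \<in> core \<Theta>"
proof -
  have "x \<in> inv R ` core \<Theta>"
    using orthogonal_transformation_invariant_image[OF orth_inv subspace_core[OF assms(1)] core_inv]
      assms(2) by simp
  then show ?thesis by auto
qed

lemma subset_coreI:
  assumes "subspace E" "\<And>x. x \<in> E \<Longrightarrow> R x \<in> E" "E \<subseteq> \<Theta>"
  shows "E \<subseteq> core \<Theta>"
proof
  fix x assume "x \<in> E"
  then have "(inv R ^^ n) x \<in> E" for n
    by (induction n) (use invariant_inv[OF assms(1,2)] in auto)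
  then show "x \<in> core \<Theta>" using assms(3) by (auto simp: core_def)
qed

end

section \<open>The sum of the series\<close>

locale observed_orthogonal_operator = orthogonal_operator +
  fixes P :: "'a \<Rightarrow> 'a" and z :: 'a and \<Theta> :: "'a set"
  assumes unit: "norm z = 1"
    and \<Theta>: "\<Theta> = {z}\<^sup>\<bottom>"
    and P: "P = orth_proj \<Theta>"
begin

section \<open>The projection onto the complement of a unit vector\<close>

lemma mem_\<Theta>: "x \<in> \<Theta> \<longleftrightarrow> x \<bullet> z = 0"
  by (simp add: \<Theta> orthogonal_comp_def orthogonal_def inner_commute)

lemma subspace_\<Theta>: "subspace \<Theta>"
  unfolding \<Theta> by (rule subspace_orthogonal_comp)

lemma P_eq: "P x = x - (x \<bullet> z) *\<^sub>R z"
  by (simp add: P \<Theta> orth_proj_hyperplane[OF unit])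

lemma z_z [simp]: "z \<bullet> z = 1"
  using unit by (simp add: norm_eq_1)

lemma norm_P: "(norm (P x))\<^sup>2 = (norm x)\<^sup>2 - (x \<bullet> z)\<^sup>2"
  unfolding P_eq power2_norm_eq_inner
  by (simp add: inner_diff_left inner_diff_right inner_commute power2_eq_square)

text \<open>This is the adjoint \<open>T\<close> of \<open>P \<circ> R\<close>: the projection is
  self-adjoint and the transpose of \<open>R\<close> is its inverse.\<close>

definition adj :: "'a \<Rightarrow> 'a" where
  "adj x = inv R (P x)"

lemma adj_eq_inv: "x \<bullet> z = 0 \<Longrightarrow> adj x = inv R x"
  unfolding adj_def P_eq by simp

lemma linear_adj: "linear adj"
proof -
  have "linear P"
    unfolding P_eq[abs_def] by (rule linearI) (auto simp: algebra_simps)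
  then show ?thesis
    using linear_compose[OF _ linear_inv] by (simp add: adj_def[abs_def] comp_def)
qed

lemma inner_adj: "P (R x) \<bullet> y = x \<bullet> adj y"
  unfolding adj_def inner_inv_right P_eq
  by (simp add: inner_diff_left inner_diff_right inner_commute)

lemma inner_funpow_adj: "((P \<circ> R) ^^ n) x \<bullet> y = x \<bullet> (adj ^^ n) y"
proof (induction n arbitrary: y)
  case (Suc n)
  have "((P \<circ> R) ^^ Suc n) x \<bullet> y = ((P \<circ> R) ^^ n) x \<bullet> adj y"
    by (simp add: inner_adj)
  also have "\<dots> = x \<bullet> (adj ^^ Suc n) y"
    by (simp add: Suc funpow_swap1)
  finally show ?case .
qed simp

text \<open>Only the projection loses length, and what it loses is the component along
  \<open>z\<close>. This identity turns the squared coefficients of the series into differences of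
  consecutive squared norms.\<close>

lemma norm_adj: "(norm (adj x))\<^sup>2 = (norm x)\<^sup>2 - (x \<bullet> z)\<^sup>2"
  by (simp add: adj_def norm_P)

lemma norm_adj_le: "norm (adj x) \<le> norm x"
  by (rule power2_le_imp_le) (simp_all add: norm_adj)

lemma norm_funpow_adj_antimono: "n \<le> m \<Longrightarrow> norm ((adj ^^ m) x) \<le> norm ((adj ^^ n) x)"
  by (induction m rule: dec_induct) (auto intro: order_trans[OF norm_adj_le])

text \<open>Constant norm means that no step loses length, so every iterate is orthogonal to
  \<open>z\<close>; on such vectors \<open>P\<close> is the identity and \<open>adj\<close> acts as
  \<open>inv R\<close>.\<close>

lemma funpow_adj_eq:
  assumes "\<And>n. norm ((adj ^^ n) x) = norm x"
  shows "(adj ^^ n) x = (inv R ^^ n) x" "x \<in> core \<Theta>"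
proof -
  have z0: "(adj ^^ n) x \<bullet> z = 0" for n
    using norm_adj[of "(adj ^^ n) x"] assms[of n] assms[of "Suc n"] by simp
  show eq: "(adj ^^ n) x = (inv R ^^ n) x" for n
  proof (induction n)
    case (Suc n)
    then show ?case using z0[of n] by (simp add: adj_eq_inv)
  qed simp
  show "x \<in> core \<Theta>"
    using z0 eq by (simp add: core_def mem_\<Theta>)
qed

lemma funpow_adj_core:
  assumes "x \<in> core \<Theta>"
  shows "(adj ^^ n) x = (inv R ^^ n) x" "norm ((adj ^^ n) x) = norm x"
proof -
  have *: "(inv R ^^ n) x \<bullet> z = 0" for n
    using assms by (simp add: core_def mem_\<Theta>)
  show eq: "(adj ^^ n) x = (inv R ^^ n) x" for n
    by (induction n) (use * in \<open>auto simp: adj_eq_inv\<close>)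
  have "norm ((inv R ^^ n) x) = norm x" by (induction n) auto
  then show "norm ((adj ^^ n) x) = norm x" by (simp add: eq)
qed

text \<open>For \<open>u\<close> in the core, \<open>R u\<close> is again in the core and is
  therefore fixed by \<open>P\<close>. The inner product of \<open>u\<close> and
  \<open>adj x\<close> thus equals that of \<open>R u\<close> and \<open>x\<close>, which is
  0.\<close>

lemma adj_core_comp:
  assumes "x \<in> (core \<Theta>)\<^sup>\<bottom>"
  shows "adj x \<in> (core \<Theta>)\<^sup>\<bottom>"
proof -
  have "u \<bullet> adj x = 0" if u: "u \<in> core \<Theta>" for u
  proof -
    have Ru: "R u \<in> core \<Theta>" using core_R[OF subspace_\<Theta> u] .
    then have "R u \<bullet> z = 0" using core_subset mem_\<Theta> by blast
    then have "u \<bullet> adj x = R u \<bullet> x"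
      using inner_adj[of u x] by (simp add: P_eq inner_diff_left)
    also have "\<dots> = 0" using Ru assms by (auto simp: orthogonal_comp_def orthogonal_def)
    finally show ?thesis .
  qed
  then show ?thesis by (auto simp: orthogonal_comp_def orthogonal_def)
qed

text \<open>A limit point \<open>y\<close> of the orbit has an orbit of constant norm, so it lies in the core as well
  as in its orthogonal complement.\<close>

lemma funpow_adj_tendsto_0:
  assumes "x \<in> (core \<Theta>)\<^sup>\<bottom>"
  shows "(\<lambda>n. norm ((adj ^^ n) x)) \<longlonglongrightarrow> 0"
proof -
  define a where "a n = norm ((adj ^^ n) x)" for n
  have "decseq a" unfolding a_def decseq_def using norm_funpow_adj_antimono by blast
  then obtain L where L: "a \<longlonglongrightarrow> L"
    using decseq_convergent[of a 0] by (auto simp: a_def)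
  have "a n \<le> norm x" for n using norm_funpow_adj_antimono[of 0 n x] by (simp add: a_def)
  then have "bounded (range (\<lambda>n. (adj ^^ n) x))"
    by (auto simp: bounded_iff a_def)
  then obtain y r where r: "strict_mono r" and y: "((\<lambda>n. (adj ^^ n) x) \<circ> r) \<longlonglongrightarrow> y"
    using bounded_imp_convergent_subsequence by blast
  have "(adj ^^ n) x \<in> (core \<Theta>)\<^sup>\<bottom>" for n
    by (induction n) (use assms adj_core_comp in auto)
  then have y_comp: "y \<in> (core \<Theta>)\<^sup>\<bottom>"
    using closed_sequentially[OF closed_subspace[OF subspace_orthogonal_comp] _ y] by (auto simp: comp_def)
  \<comment> \<open>By continuity this norm is the limit of \<open>a (r n + m)\<close>. The shifted
    index is still strictly increasing in \<open>n\<close>, so the limit is \<open>L\<close> for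
    every \<open>m\<close>.\<close>
  have norm_y: "norm ((adj ^^ m) y) = L" for m
  proof -
    have "linear (adj ^^ m)"
    proof (induction m)
      case (Suc m)
      then have "linear (adj \<circ> adj ^^ m)" by (rule linear_compose[OF _ linear_adj])
      then show ?case unfolding funpow.simps .
    qed (simp add: linear_iff)
    then have "(\<lambda>n. norm ((adj ^^ m) ((adj ^^ r n) x))) \<longlonglongrightarrow> norm ((adj ^^ m) y)"
      using bounded_linear.tendsto[of "adj ^^ m", OF _ y] unfolding comp_def
      by (simp add: linear_conv_bounded_linear tendsto_norm)
    moreover have "(\<lambda>n. a (r n + m)) \<longlonglongrightarrow> L"
      using LIMSEQ_subseq_LIMSEQ[OF L, of "\<lambda>n. r n + m"] r
      by (auto simp: strict_mono_def comp_def)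
    ultimately show ?thesis
      by (auto simp: a_def funpow_add add.commute intro: LIMSEQ_unique)
  qed
  then have "norm ((adj ^^ m) y) = norm y" for m
    using norm_y[of 0] by simp
  then have "y \<in> core \<Theta>" by (rule funpow_adj_eq(2))
  with y_comp have "y = 0" by (auto simp: orthogonal_comp_def orthogonal_self)
  then have "L = 0" using norm_y[of 0] by simp
  then show ?thesis using L by (simp add: a_def[abs_def])
qed

section \<open>Telescoping over an orthonormal basis\<close>

lemma sums_dim_core:
  "(\<lambda>n. (norm (((P \<circ> R) ^^ n) z))\<^sup>2) sums (real DIM('a) - real (dim (core \<Theta>)))"
proof -
  let ?U = "core \<Theta>" and ?V = "(core \<Theta>)\<^sup>\<bottom>"
  have sU: "subspace ?U" by (rule subspace_core[OF subspace_\<Theta>])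
  obtain B where B: "B \<subseteq> ?U" "pairwise orthogonal B" "\<And>x. x \<in> B \<Longrightarrow> norm x = 1"
    "independent B" "card B = dim ?U" "span B = ?U"
    using orthonormal_basis_subspace[OF sU] by metis
  obtain D where D: "D \<subseteq> ?V" "pairwise orthogonal D" "\<And>x. x \<in> D \<Longrightarrow> norm x = 1"
    "independent D" "card D = dim ?V" "span D = ?V"
    using orthonormal_basis_subspace[OF subspace_orthogonal_comp] by metis
  have fin: "finite B" "finite D" using B(4) D(4) by (simp_all add: independent_imp_finite)
  have BD: "orthogonal b d" if "b \<in> B" "d \<in> D" for b d
    using that B(1) D(1) by (auto simp: orthogonal_comp_def)
  have disj: "B \<inter> D = {}" using BD B(3) by (force simp: orthogonal_self)
  have po: "pairwise orthogonal (B \<union> D)"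
    using B(2) D(2) BD by (auto simp: pairwise_def intro: BD[THEN orthogonal_commute[THEN iffD1]])
  have un: "norm b = 1" if "b \<in> B \<union> D" for b using that B(3) D(3) by auto
  have span: "span (B \<union> D) = UNIV"
  proof -
    have "x \<in> span (B \<union> D)" for x
    proof -
      obtain y w where "y \<in> ?U" "w \<in> ?V" "x = y + w"
        using subspace_sum_orthogonal_comp[OF sU] by (metis UNIV_I set_plus_elim)
      then show ?thesis using B(6) D(6)
        by (metis span_add span_mono subsetD sup_ge1 sup_ge2)
    qed
    then show ?thesis by blast
  qed
  have "card (B \<union> D) = dim (span (B \<union> D))"
    using po un pairwise_orthogonal_independent[of "B \<union> D"]
    by (metis dim_span_eq_card_independent norm_zero zero_neq_one)
  then have card: "card D + dim ?U = DIM('a)"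
    using card_Un_disjoint[OF fin disj] B(5) by (simp add: span)
  \<comment> \<open>Only \<open>D\<close> remains: each element of \<open>B\<close> contributes 0,
    because \<open>adj\<close> preserves norms along orbits in the core.\<close>
  have part: "(\<Sum>n<N. (norm (((P \<circ> R) ^^ n) z))\<^sup>2) =
      real (card D) - (\<Sum>d\<in>D. (norm ((adj ^^ N) d))\<^sup>2)" for N
  proof -
    \<comment> \<open>The coefficient of \<open>((P \<circ> R) ^^ n) z\<close> at \<open>b\<close>
      is the inner product of \<open>z\<close> with \<open>(adj ^^ n) b\<close>, and its square is
      the squared length that this vector loses in the next application of
      \<open>adj\<close>.\<close>
    have summand: "(norm (((P \<circ> R) ^^ n) z))\<^sup>2 =
        (\<Sum>b\<in>B \<union> D. (norm ((adj ^^ n) b))\<^sup>2 - (norm ((adj ^^ Suc n) b))\<^sup>2)" for n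
    proof -
      have "(norm (((P \<circ> R) ^^ n) z))\<^sup>2 = (\<Sum>b\<in>B \<union> D. (((P \<circ> R) ^^ n) z \<bullet> b)\<^sup>2)"
        by (rule parseval[OF po un span])
      moreover have "(((P \<circ> R) ^^ n) z \<bullet> b)\<^sup>2 =
          (norm ((adj ^^ n) b))\<^sup>2 - (norm ((adj ^^ Suc n) b))\<^sup>2" for b
        unfolding inner_funpow_adj using norm_adj[of "(adj ^^ n) b"] by (simp add: inner_commute)
      ultimately show ?thesis by (simp only:)
    qed
    have "(\<Sum>n<N. (norm (((P \<circ> R) ^^ n) z))\<^sup>2) =
        (\<Sum>b\<in>B \<union> D. \<Sum>n<N. (norm ((adj ^^ n) b))\<^sup>2 - (norm ((adj ^^ Suc n) b))\<^sup>2)"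
      unfolding summand by (rule sum.swap)
    also have "\<dots> = (\<Sum>b\<in>B \<union> D. (norm b)\<^sup>2 - (norm ((adj ^^ N) b))\<^sup>2)"
    proof (intro sum.cong refl)
      show "(\<Sum>n<N. (norm ((adj ^^ n) b))\<^sup>2 - (norm ((adj ^^ Suc n) b))\<^sup>2) =
          (norm b)\<^sup>2 - (norm ((adj ^^ N) b))\<^sup>2" for b
        using sum_lessThan_telescope'[of "\<lambda>n. (norm ((adj ^^ n) b))\<^sup>2" N] by simp
    qed
    also have "\<dots> = (\<Sum>b\<in>B. (norm b)\<^sup>2 - (norm ((adj ^^ N) b))\<^sup>2)
        + (\<Sum>b\<in>D. (norm b)\<^sup>2 - (norm ((adj ^^ N) b))\<^sup>2)"
      by (rule sum.union_disjoint[OF fin disj])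
    also have "(\<Sum>b\<in>B. (norm b)\<^sup>2 - (norm ((adj ^^ N) b))\<^sup>2) = 0"
      by (rule sum.neutral) (use B(1) funpow_adj_core(2) in auto)
    also have "(\<Sum>b\<in>D. (norm b)\<^sup>2 - (norm ((adj ^^ N) b))\<^sup>2) =
        real (card D) - (\<Sum>d\<in>D. (norm ((adj ^^ N) d))\<^sup>2)"
      by (simp add: sum_subtractf D(3))
    finally show ?thesis by (simp only: add_0)
  qed
  have "(\<lambda>N. real (card D) - (\<Sum>d\<in>D. (norm ((adj ^^ N) d))\<^sup>2)) \<longlonglongrightarrow>
      real (card D) - (\<Sum>d\<in>D. 0\<^sup>2)"
    using D(1) by (intro tendsto_intros funpow_adj_tendsto_0) auto
  moreover have "real (card D) - (\<Sum>d\<in>D. 0\<^sup>2) = real DIM('a) - real (dim ?U)"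
    using card by simp
  ultimately show ?thesis unfolding sums_def part by simp
qed

end

section \<open>Invariant planes\<close>

context orthogonal_operator
begin

section \<open>Real eigenvalues and eigenspaces\<close>

lemma mem_eigenspace: "x \<in> eigenspace R \<mu> \<longleftrightarrow> R x = \<mu> *\<^sub>R x"
  by (simp add: eigenspace_def)

lemma subspace_eigenspace: "subspace (eigenspace R \<mu>)"
  unfolding subspace_def
  by (simp add: mem_eigenspace linear_0[OF linear_R] linear_add[OF linear_R]
      linear_cmul[OF linear_R] scaleR_add_right mult.commute)

lemma eigenvalue_abs:
  assumes "R x = \<mu> *\<^sub>R x" "x \<noteq> 0"
  shows "\<mu> \<in> {-1, 1}"
proof -
  have "\<bar>\<mu>\<bar> * norm x = norm x" using norm_R[of x] assms(1) by simp
  then show ?thesis using assms(2) by auto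
qed

lemma mem_real_spectrum: "\<mu> \<in> real_spectrum R \<longleftrightarrow> (\<exists>x. x \<noteq> 0 \<and> R x = \<mu> *\<^sub>R x)"
  unfolding real_spectrum_def using subspace_0[OF subspace_eigenspace[of \<mu>]]
  by (auto simp: mem_eigenspace[symmetric])

lemma real_spectrum_subset: "real_spectrum R \<subseteq> {-1, 1}"
  using eigenvalue_abs unfolding mem_real_spectrum subset_iff by blast

lemma finite_real_spectrum: "finite (real_spectrum R)"
  by (rule finite_subset[OF real_spectrum_subset]) simp

text \<open>Distinct members of {-1, 1} have product -1, so invariance of the inner product under
  \<open>R\<close> makes \<open>x \<bullet> y\<close> equal to its own negative.\<close>

lemma orthogonal_eigenspaces:
  assumes "\<mu> \<in> real_spectrum R" "\<nu> \<in> real_spectrum R" "\<mu> \<noteq> \<nu>"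
    and "x \<in> eigenspace R \<mu>" "y \<in> eigenspace R \<nu>"
  shows "orthogonal x y"
proof -
  have "\<mu> \<in> {-1, 1}" "\<nu> \<in> {-1, 1}" using assms(1,2) real_spectrum_subset by blast+
  then have "\<mu> * \<nu> = -1" using assms(3) by auto
  moreover have "(\<mu> * \<nu>) * (x \<bullet> y) = x \<bullet> y"
    using inner_R[of x y] assms(4,5) by (simp add: mem_eigenspace mult.commute)
  ultimately show ?thesis by (simp add: orthogonal_def)
qed

text \<open>With this, invariance and the identity for \<open>R + inv R\<close> need to be checked
  only on vectors spanning a plane.\<close>

lemma subspace_cosine:
  assumes "subspace A"
  shows "subspace {x. R x \<in> A \<and> R x + inv R x = c *\<^sub>R x}"
proof -
  let ?f = "\<lambda>x. R x + inv R x - c *\<^sub>R x"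
  have "linear ?f"
    by (intro linear_compose_sub linear_compose_add linear_R linear_inv linear_compose_scale_right
        linear_ident)
  then have "subspace {x. ?f x = 0}" by (rule linear_subspace_kernel)
  moreover have "subspace (R -` A)" using assms linear_R by (rule linear_subspace_vimage[rotated])
  ultimately have "subspace (R -` A \<inter> {x. ?f x = 0})" by (intro subspace_inter)
  moreover have "{x. R x \<in> A \<and> R x + inv R x = c *\<^sub>R x} = R -` A \<inter> {x. ?f x = 0}" by auto
  ultimately show ?thesis by simp
qed

text \<open>The inverse is the rotation with \<open>s\<close> negated; the sine terms cancel in the
  sum. The opposite orientation is covered by taking \<open>- s\<close> for
  \<open>s\<close>.\<close>

lemma rotation_cosine:
  assumes "c\<^sup>2 + s\<^sup>2 = 1" "R u = c *\<^sub>R u - s *\<^sub>R v" "R v = s *\<^sub>R u + c *\<^sub>R v"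
  shows "R u + inv R u = (2 * c) *\<^sub>R u" "R v + inv R v = (2 * c) *\<^sub>R v"
proof -
  have "R (c *\<^sub>R u + s *\<^sub>R v) = (c\<^sup>2 + s\<^sup>2) *\<^sub>R u"
    by (simp add: linear_add[OF linear_R] linear_cmul[OF linear_R] assms(2,3)
        algebra_simps power2_eq_square)
  then have "inv R u = c *\<^sub>R u + s *\<^sub>R v" using assms(1) by (metis inv_R scaleR_one)
  then show "R u + inv R u = (2 * c) *\<^sub>R u" by (simp add: assms(2) flip: scaleR_add_left)
  have "R (c *\<^sub>R v - s *\<^sub>R u) = (c\<^sup>2 + s\<^sup>2) *\<^sub>R v"
    by (simp add: linear_diff[OF linear_R] linear_cmul[OF linear_R] assms(2,3)
        algebra_simps power2_eq_square)
  then have "inv R v = c *\<^sub>R v - s *\<^sub>R u" using assms(1) by (metis inv_R scaleR_one)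
  then show "R v + inv R v = (2 * c) *\<^sub>R v" by (simp add: assms(3) flip: scaleR_add_left)
qed

text \<open>A basis-free form in which the angle enters only through its cosine. From left to right
  one orthonormal basis suffices. From right to left, the identity for \<open>R + inv R\<close>
  fixes the diagonal of the matrix and makes the rest antisymmetric, and preservation of length
  gives the sine up to sign.\<close>

lemma rotates_plane_by_iff:
  "rotates_plane_by R A \<phi> \<longleftrightarrow>
    subspace A \<and> dim A = 2 \<and> (\<forall>x\<in>A. R x \<in> A \<and> R x + inv R x = (2 * cos \<phi>) *\<^sub>R x)"
proof (intro iffI conjI)
  assume rot: "rotates_plane_by R A \<phi>"
  then show sA: "subspace A" and dA: "dim A = 2" by (auto simp: rotates_plane_by_def)
  obtain B where B: "B \<subseteq> A" "pairwise orthogonal B" "\<And>x. x \<in> B \<Longrightarrow> norm x = 1"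
    "card B = dim A" "span B = A"
    using orthonormal_basis_subspace[OF sA] by metis
  then obtain u v where uv: "B = {u, v}" "u \<noteq> v" using dA by (auto simp: card_2_iff)
  then have "orthonormal_basis2 A u v"
    using B by (auto simp: orthonormal_basis2_def pairwise_def)
  with rot have cases:
      "(R u = cos \<phi> *\<^sub>R u - sin \<phi> *\<^sub>R v \<and> R v = sin \<phi> *\<^sub>R u + cos \<phi> *\<^sub>R v) \<or>
       (R u = cos \<phi> *\<^sub>R u + sin \<phi> *\<^sub>R v \<and> R v = - sin \<phi> *\<^sub>R u + cos \<phi> *\<^sub>R v)"
    by (simp add: rotates_plane_by_def)
  let ?T = "{x. R x \<in> A \<and> R x + inv R x = (2 * cos \<phi>) *\<^sub>R x}"
  have uvA: "u \<in> A" "v \<in> A" using B(1) uv by auto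
  have "u \<in> ?T \<and> v \<in> ?T"
    using cases
  proof
    assume *: "R u = cos \<phi> *\<^sub>R u - sin \<phi> *\<^sub>R v \<and> R v = sin \<phi> *\<^sub>R u + cos \<phi> *\<^sub>R v"
    have "R u \<in> A" "R v \<in> A"
      unfolding conjunct1[OF *] conjunct2[OF *]
      using uvA sA by (auto intro!: subspace_diff subspace_add subspace_scale)
    then show ?thesis using rotation_cosine[of "cos \<phi>" "sin \<phi>" u v] * by simp
  next
    assume *: "R u = cos \<phi> *\<^sub>R u + sin \<phi> *\<^sub>R v \<and> R v = - sin \<phi> *\<^sub>R u + cos \<phi> *\<^sub>R v"
    have "R u \<in> A" "R v \<in> A"
      unfolding conjunct1[OF *] conjunct2[OF *]
      using uvA sA by (auto intro!: subspace_diff subspace_add subspace_scale)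
    then show ?thesis using rotation_cosine[of "cos \<phi>" "- sin \<phi>" u v] * by simp
  qed
  then have "span B \<subseteq> ?T"
    by (intro span_minimal subspace_cosine sA) (auto simp: uv)
  then show "\<forall>x\<in>A. R x \<in> A \<and> R x + inv R x = (2 * cos \<phi>) *\<^sub>R x" using B(5) by blast
next
  assume *: "subspace A \<and> dim A = 2 \<and>
    (\<forall>x\<in>A. R x \<in> A \<and> R x + inv R x = (2 * cos \<phi>) *\<^sub>R x)"
  show "rotates_plane_by R A \<phi>"
    unfolding rotates_plane_by_def
  proof (intro conjI allI impI)
    fix u v assume uv: "orthonormal_basis2 A u v"
    have A: "A = span {u, v}" and [simp]: "u \<bullet> u = 1" "v \<bullet> v = 1" "u \<bullet> v = 0" "v \<bullet> u = 0"
      using uv by (auto simp: orthonormal_basis2_def orthogonal_def norm_eq_1 inner_commute)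
    then have uvA: "u \<in> A" "v \<in> A" by (auto intro: span_base)
    then have "R u \<in> span {u, v}" "R v \<in> span {u, v}" using * A by auto
    then obtain a b a' b' where
      Ru: "R u = a *\<^sub>R u + b *\<^sub>R v" and Rv: "R v = a' *\<^sub>R u + b' *\<^sub>R v"
      unfolding span_breakdown_eq span_empty by (auto simp: algebra_simps)
    have Cu: "R u + inv R u = (2 * cos \<phi>) *\<^sub>R u" and Cv: "R v + inv R v = (2 * cos \<phi>) *\<^sub>R v"
      using * uvA by auto
    \<comment> \<open>Pairing with \<open>u\<close> turns the left side of \<open>Cu\<close> into
      twice the inner product of \<open>u\<close> and \<open>R u\<close>, that is
      \<open>2 * a\<close>.\<close>
    have a: "a = cos \<phi>"
      using arg_cong[OF Cu, of "\<lambda>x. u \<bullet> x"]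
      by (simp add: inner_add_right inner_inv_right) (simp add: Ru inner_add_left inner_add_right)
    have b': "b' = cos \<phi>"
      using arg_cong[OF Cv, of "\<lambda>x. v \<bullet> x"]
      by (simp add: inner_add_right inner_inv_right) (simp add: Rv inner_add_left inner_add_right)
    \<comment> \<open>Pairing \<open>Cv\<close> with \<open>u\<close> makes the right side 0, while
      the left side is \<open>a' + b\<close>.\<close>
    have a': "a' = - b"
      using arg_cong[OF Cv, of "\<lambda>x. u \<bullet> x"]
      by (simp add: inner_add_right inner_inv_right)
        (simp add: Ru Rv inner_add_left inner_add_right)
    have "a\<^sup>2 + b\<^sup>2 = 1"
      using inner_R[of u u] by (simp add: Ru inner_add_left inner_add_right power2_eq_square)
    then have "b\<^sup>2 = (sin \<phi>)\<^sup>2" using sin_cos_squared_add[of \<phi>] unfolding a by linarith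
    then have "b = sin \<phi> \<or> b = - sin \<phi>" by (simp add: power2_eq_iff)
    then show "(R u = cos \<phi> *\<^sub>R u - sin \<phi> *\<^sub>R v \<and> R v = sin \<phi> *\<^sub>R u + cos \<phi> *\<^sub>R v) \<or>
        (R u = cos \<phi> *\<^sub>R u + sin \<phi> *\<^sub>R v \<and> R v = - sin \<phi> *\<^sub>R u + cos \<phi> *\<^sub>R v)"
      using Ru Rv a a' b' by auto
  qed (use * in auto)
qed

section \<open>Splitting invariant subspaces into planes\<close>

text \<open>Applying \<open>R\<close> to the assumed identity expresses \<open>R (R x)\<close>
  through \<open>R x\<close> and \<open>x\<close>, so the span is invariant. Cauchy-Schwarz bounds
  \<open>c\<close> by 1 in absolute value, so that \<open>arccos c\<close> really has cosine
  \<open>c\<close>.\<close>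

lemma rotates_plane_byI:
  assumes "x \<noteq> 0" "R x + inv R x = (2 * c) *\<^sub>R x" "R x \<notin> span {x}"
  shows "rotates_plane_by R (span {x, R x}) (arccos c)"
proof -
  let ?A = "span {x, R x}"
  have "2 * (x \<bullet> R x) = 2 * c * (x \<bullet> x)"
    using arg_cong[OF assms(2), of "\<lambda>y. x \<bullet> y"]
    by (simp add: inner_add_right inner_inv_right inner_commute)
  moreover have "\<bar>x \<bullet> R x\<bar> \<le> x \<bullet> x"
    using Cauchy_Schwarz_ineq2[of x "R x"] by (simp add: power2_norm_eq_inner flip: power2_eq_square)
  ultimately have "\<bar>c\<bar> * (x \<bullet> x) \<le> 1 * (x \<bullet> x)" by (simp add: abs_mult)
  then have "\<bar>c\<bar> \<le> 1" using assms(1) by (simp add: mult_le_cancel_right)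
  then have c: "cos (arccos c) = c" by (auto simp: abs_le_iff intro: cos_arccos)
  have "dim {R x, x} = 2" using assms(1,3) by (simp add: dim_insert)
  then have dim: "dim ?A = 2" by (simp add: insert_commute)
  have RR: "R (R x) + x = (2 * c) *\<^sub>R R x"
    using arg_cong[OF assms(2), of R] by (simp add: linear_add[OF linear_R] linear_cmul[OF linear_R])
  then have "R (R x) = (2 * c) *\<^sub>R R x - x" by (simp add: algebra_simps)
  also have "\<dots> \<in> ?A" by (intro span_diff span_scale) (auto intro: span_base)
  finally have "{x, R x} \<subseteq> {y. R y \<in> ?A \<and> R y + inv R y = (2 * c) *\<^sub>R y}"
    using assms(2) RR by (auto intro: span_base)
  then have "?A \<subseteq> {y. R y \<in> ?A \<and> R y + inv R y = (2 * c) *\<^sub>R y}"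
    by (rule span_minimal) (rule subspace_cosine[OF subspace_span])
  then show ?thesis unfolding rotates_plane_by_iff c using dim by auto
qed

text \<open>The eigenvector maximizes the quadratic form of \<open>R\<close> on the unit sphere of \<open>E\<close>.\<close>

lemma ex_cosine_eigenvector:
  assumes sE: "subspace E" and inv: "\<And>x. x \<in> E \<Longrightarrow> R x \<in> E" and "E \<noteq> {0}"
  shows "\<exists>x\<in>E. \<exists>c. norm x = 1 \<and> R x + inv R x = (2 * c) *\<^sub>R x"
proof -
  let ?K = "E \<inter> sphere 0 1"
  obtain e where e: "e \<in> E" "e \<noteq> 0" using assms(3) subspace_0[OF sE] by blast
  then have "(1 / norm e) *\<^sub>R e \<in> ?K" using sE by (simp add: subspace_scale)
  then have "?K \<noteq> {}" by blast
  moreover have "compact ?K" by (intro closed_Int_compact closed_subspace sE compact_sphere)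
  moreover have "continuous_on ?K (\<lambda>x. x \<bullet> R x)"
    by (intro continuous_intros linear_continuous_on linear_R[unfolded linear_conv_bounded_linear])
  ultimately obtain x where x: "x \<in> ?K" and max: "\<And>y. y \<in> ?K \<Longrightarrow> y \<bullet> R y \<le> x \<bullet> R x"
    using continuous_attains_sup by metis
  define m where "m = x \<bullet> R x"
  have xE: "x \<in> E" and nx: "x \<bullet> x = 1" using x by (auto simp: norm_eq_1)
  have le: "y \<bullet> R y \<le> m * (y \<bullet> y)" if "y \<in> E" for y
  proof (cases "y = 0")
    case False
    let ?y = "(1 / norm y) *\<^sub>R y"
    have "?y \<bullet> R ?y \<le> m"
      unfolding m_def using that False sE by (intro max) (simp add: subspace_scale)
    then have "(y \<bullet> R y) / (norm y)\<^sup>2 \<le> m"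
      by (simp add: linear_cmul[OF linear_R] power2_eq_square)
    then show ?thesis using False by (simp add: field_simps power2_norm_eq_inner)
  qed simp
  \<comment> \<open>On \<open>E\<close> the form
    \<open>y \<bullet> R y - m * (y \<bullet> y)\<close> is at most 0, with value 0 at
    \<open>x\<close>; \<open>w\<close> is its gradient there and has to vanish.\<close>
  define w where "w = R x + inv R x - (2 * m) *\<^sub>R x"
  have wE: "w \<in> E"
    unfolding w_def using xE inv invariant_inv[OF sE inv] sE
    by (intro subspace_diff subspace_add subspace_scale) auto
  have CS: "\<bar>y \<bullet> R y\<bar> \<le> y \<bullet> y" for y
    using Cauchy_Schwarz_ineq2[of y "R y"] by (simp add: power2_norm_eq_inner flip: power2_eq_square)
  have "w \<bullet> R x + w \<bullet> inv R x - 2 * m * (w \<bullet> x) = w \<bullet> w"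
    by (simp add: w_def inner_diff_right inner_add_right)
  then have "w \<bullet> R x + x \<bullet> R w - 2 * m * (x \<bullet> w) = w \<bullet> w"
    by (simp add: inner_inv_right inner_commute)
  \<comment> \<open>A step of length 1/4 along the gradient: the first-order gain is
    \<open>(w \<bullet> w) / 4\<close>, whereas by Cauchy-Schwarz the second-order term costs at
    most \<open>(w \<bullet> w) / 8\<close>. The form would become positive unless
    \<open>w = 0\<close>.\<close>
  moreover have "(x + (1/4) *\<^sub>R w) \<bullet> R (x + (1/4) *\<^sub>R w) \<le>
      m * ((x + (1/4) *\<^sub>R w) \<bullet> (x + (1/4) *\<^sub>R w))"
    by (intro le subspace_add subspace_scale sE xE wE)
  then have "m + (w \<bullet> R x + x \<bullet> R w) / 4 + (w \<bullet> R w) / 16 \<le>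
      m * (1 + (x \<bullet> w) / 2 + (w \<bullet> w) / 16)"
    by (simp add: linear_add[OF linear_R] linear_cmul[OF linear_R] inner_add_left inner_add_right
        m_def[symmetric] nx inner_commute[of w x] algebra_simps add_divide_distrib)
  moreover have "m * (1 + (x \<bullet> w) / 2 + (w \<bullet> w) / 16) = m + m * (x \<bullet> w) / 2 + m * (w \<bullet> w) / 16"
    by (simp add: algebra_simps)
  ultimately have "(w \<bullet> w) / 4 \<le> m * (w \<bullet> w) / 16 - (w \<bullet> R w) / 16" by argo
  moreover have "m * (w \<bullet> w) \<le> 1 * (w \<bullet> w)"
    using CS[of x] by (intro mult_right_mono) (auto simp: m_def nx)
  ultimately have "w \<bullet> w \<le> 0" using CS[of w] by linarith
  then have "w = 0" using inner_ge_zero[of w] inner_eq_zero_iff[of w] by linarith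
  then have "R x + inv R x = (2 * m) *\<^sub>R x" by (simp add: w_def)
  then show ?thesis using x by auto
qed

text \<open>A set instead of an indexed family: adding a plane is then \<open>insert\<close> and
  joining two families is a union. The planes are enumerated only in the final
  decomposition.\<close>

definition orthogonal_planes :: "'a set set \<Rightarrow> 'a set \<Rightarrow> bool" where
  "orthogonal_planes \<A> E \<longleftrightarrow> finite \<A> \<and> (\<forall>A\<in>\<A>. invariant_plane R A) \<and>
    (\<forall>A\<in>\<A>. \<forall>B\<in>\<A>. A \<noteq> B \<longrightarrow> (\<forall>x\<in>A. \<forall>y\<in>B. orthogonal x y)) \<and> span (\<Union>\<A>) = E"

lemma orthogonal_planesD:
  assumes "orthogonal_planes \<A> E"
  shows "finite \<A>" "\<And>A. A \<in> \<A> \<Longrightarrow> invariant_plane R A"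
    and "\<And>A B x y. A \<in> \<A> \<Longrightarrow> B \<in> \<A> \<Longrightarrow> A \<noteq> B \<Longrightarrow> x \<in> A \<Longrightarrow> y \<in> B \<Longrightarrow> orthogonal x y"
    and "span (\<Union>\<A>) = E" "\<And>A. A \<in> \<A> \<Longrightarrow> A \<subseteq> E"
proof -
  show sp: "span (\<Union>\<A>) = E" using assms by (simp add: orthogonal_planes_def)
  show "A \<subseteq> E" if "A \<in> \<A>" for A
    using that span_superset[of "\<Union>\<A>"] unfolding sp by blast
qed (use assms in \<open>auto simp: orthogonal_planes_def\<close>)

text \<open>A vector \<open>x\<close> from \<open>ex_cosine_eigenvector\<close> is not an
  eigenvector of \<open>R\<close>, so \<open>x\<close> and \<open>R x\<close> span an invariant
  plane. Its complement within \<open>E\<close> is invariant, has no eigenvectors and has smaller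
  dimension.\<close>

lemma ex_plane_decomposition:
  assumes "subspace E" "\<And>x. x \<in> E \<Longrightarrow> R x \<in> E"
    and "\<And>x t. x \<in> E \<Longrightarrow> R x = t *\<^sub>R x \<Longrightarrow> x = 0"
  shows "\<exists>\<A>. orthogonal_planes \<A> E"
  using assms
proof (induction "dim E" arbitrary: E rule: less_induct)
  case less
  show ?case
  proof (cases "E = {0}")
    case True
    then show ?thesis by (intro exI[of _ "{}"]) (simp add: orthogonal_planes_def)
  next
    case False
    then obtain x c where x: "x \<in> E" "norm x = 1" "R x + inv R x = (2 * c) *\<^sub>R x"
      using ex_cosine_eigenvector[OF less.prems(1,2)] by blast
    have "x \<noteq> 0" using x(2) by auto
    have "R x \<notin> span {x}"
      using less.prems(3)[OF x(1)] \<open>x \<noteq> 0\<close> by (auto simp: span_singleton)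
    define A where "A = span {x, R x}"
    have rot: "rotates_plane_by R A (arccos c)"
      unfolding A_def by (rule rotates_plane_byI) fact+
    then have sA: "subspace A" and dA: "dim A = 2" and RA: "\<And>y. y \<in> A \<Longrightarrow> R y \<in> A"
      by (auto simp: rotates_plane_by_iff)
    have AE: "A \<subseteq> E" unfolding A_def
      using x(1) less.prems(1,2) by (intro span_minimal) auto
    let ?F = "E \<inter> A\<^sup>\<bottom>"
    have sF: "subspace ?F" by (intro subspace_inter less.prems subspace_orthogonal_comp)
    have xA: "x \<in> A" unfolding A_def by (auto intro: span_base)
    then have "x \<notin> A\<^sup>\<bottom>" using \<open>x \<noteq> 0\<close> orthogonal_self[of x] by (auto simp: orthogonal_comp_def)
    then have "?F \<subset> E" using x(1) by blast
    then have dF: "dim ?F < dim E"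
      using sF less.prems(1) by (metis dim_psubset span_eq_iff)
    have RF: "R y \<in> ?F" if "y \<in> ?F" for y
      using that less.prems(2) invariant_orthogonal_comp[OF sA RA] by auto
    have no_eigen: "y = 0" if "y \<in> ?F" "R y = t *\<^sub>R y" for y t
      using that less.prems(3) by blast
    have "\<exists>\<A>. orthogonal_planes \<A> ?F"
      by (rule less.hyps[OF dF sF]) (fact RF, fact no_eigen)
    then obtain \<A> where \<A>: "orthogonal_planes \<A> ?F" by blast
    note sp = orthogonal_planesD(4)[OF \<A>] and BF = orthogonal_planesD(5)[OF \<A>]
    have oA: "orthogonal a b" "orthogonal b a" if "a \<in> A" "b \<in> B" "B \<in> \<A>" for a b B
      using that BF[OF that(3)] by (auto simp: orthogonal_comp_def orthogonal_commute)
    have "span (\<Union>(insert A \<A>)) = E"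
    proof
      show "span (\<Union>(insert A \<A>)) \<subseteq> E"
        using AE BF less.prems(1) by (intro span_minimal) auto
      show "E \<subseteq> span (\<Union>(insert A \<A>))"
      proof
        fix y assume y: "y \<in> E"
        obtain a b where ab: "a \<in> A" "b \<in> A\<^sup>\<bottom>" "y = a + b"
          using subspace_sum_orthogonal_comp[OF sA] by (metis UNIV_I set_plus_elim)
        have "y - a \<in> E" using subspace_diff[OF less.prems(1) y] ab(1) AE by blast
        then have "b \<in> ?F" using ab by simp
        then have "b \<in> span (\<Union>(insert A \<A>))"
          using sp span_mono[of "\<Union>\<A>" "\<Union>(insert A \<A>)"] by blast
        moreover have "a \<in> span (\<Union>(insert A \<A>))" using ab by (auto intro: span_base)
        ultimately show "y \<in> span (\<Union>(insert A \<A>))" unfolding ab(3) by (intro span_add)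
      qed
    qed
    moreover have "finite (insert A \<A>)" using orthogonal_planesD(1)[OF \<A>] by simp
    moreover have "invariant_plane R A" using rot by (auto simp: invariant_plane_def)
    ultimately have "orthogonal_planes (insert A \<A>) E"
      using orthogonal_planesD(1-3)[OF \<A>] oA unfolding orthogonal_planes_def by blast
    then show ?thesis by blast
  qed
qed

end

section \<open>Adapted decompositions\<close>

context observed_orthogonal_operator
begin

text \<open>\<open>R\<close> acts as a scalar on the eigenspace, so every subspace of it is
  invariant, in particular its intersection with \<Theta>.\<close>

lemma core_Int_eigenspace: "core \<Theta> \<inter> eigenspace R \<mu> = \<Theta> \<inter> eigenspace R \<mu>"
proof
  have "\<Theta> \<inter> eigenspace R \<mu> \<subseteq> core \<Theta>"
  proof (rule subset_coreI)
    show "subspace (\<Theta> \<inter> eigenspace R \<mu>)"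
      by (intro subspace_inter subspace_\<Theta> subspace_eigenspace)
    show "R x \<in> \<Theta> \<inter> eigenspace R \<mu>" if "x \<in> \<Theta> \<inter> eigenspace R \<mu>" for x
    proof -
      have "R x = \<mu> *\<^sub>R x" using that by (simp add: mem_eigenspace)
      then show ?thesis
        using that by (simp add: subspace_scale subspace_\<Theta> subspace_eigenspace)
    qed
  qed simp
  then show "\<Theta> \<inter> eigenspace R \<mu> \<subseteq> core \<Theta> \<inter> eigenspace R \<mu>" by blast
qed (use core_subset in blast)

text \<open>All or nothing: a nonzero \<open>x\<close> in the intersection is no eigenvector, so
  \<open>x\<close> and \<open>R x\<close> span \<open>A\<close>, and both lie in the core.\<close>

lemma core_Int_plane:
  assumes rot: "rotates_plane_by R A \<phi>"
    and no_eigen: "\<And>x t. x \<in> A \<Longrightarrow> R x = t *\<^sub>R x \<Longrightarrow> x = 0"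
  shows "core \<Theta> \<inter> A = (if A \<subseteq> \<Theta> then A else {0})"
proof -
  have sA: "subspace A" and dA: "dim A = 2" and RA: "\<And>x. x \<in> A \<Longrightarrow> R x \<in> A"
    using rot by (auto simp: rotates_plane_by_iff)
  have sU: "subspace (core \<Theta>)" by (rule subspace_core[OF subspace_\<Theta>])
  have "A \<subseteq> \<Theta>" if x: "x \<in> core \<Theta>" "x \<in> A" "x \<noteq> 0" for x
  proof -
    have "R x \<notin> span {x}"
      using no_eigen[OF x(2)] x(3) by (auto simp: span_singleton)
    then have "dim {R x, x} = 2" using x(3) by (simp add: dim_insert)
    moreover have "span {R x, x} \<subseteq> A" by (rule span_minimal) (use x RA sA in auto)
    ultimately have "span {R x, x} = A"
      by (intro subspace_dim_equal) (use sA dA in auto)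
    moreover have "span {R x, x} \<subseteq> core \<Theta>"
      by (rule span_minimal) (use x(1) core_R[OF subspace_\<Theta>] sU in auto)
    ultimately show ?thesis using core_subset by blast
  qed
  moreover have "A \<subseteq> core \<Theta>" if "A \<subseteq> \<Theta>" by (rule subset_coreI[OF sA RA that])
  ultimately show ?thesis using subspace_0[OF sA] subspace_0[OF sU] by auto
qed

lemma dim_core:
  assumes dec: "invariant_plane_decomposition R k A" and adapted: "adapted_planes R \<Theta> k A"
  shows "real (dim (core \<Theta>)) = (\<Sum>\<mu>\<in>real_spectrum R. real (dim (\<Theta> \<inter> eigenspace R \<mu>)))
    + 2 * real (card {j\<in>{1..k}. A j \<subseteq> \<Theta>})"
proof -
  let ?I = "Inl ` real_spectrum R \<union> Inr ` {1..k}" and ?S = "case_sum (eigenspace R) A"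
  let ?U = "core \<Theta>" and ?K = "{j\<in>{1..k}. A j \<subseteq> \<Theta>}"
  have sU: "subspace ?U" by (rule subspace_core[OF subspace_\<Theta>])
  have fin: "finite ?I" using finite_real_spectrum by simp
  have od: "orthogonal_decomposition ?I ?S"
    using dec by (simp add: invariant_plane_decomposition_def)
  have ortho: "orthogonal x y"
    if "i \<in> ?I" "j \<in> ?I" "i \<noteq> j" "x \<in> ?S i" "y \<in> ?S j" for i j x y
    using od that unfolding orthogonal_decomposition_def by blast
  have "\<forall>j\<in>{1..k}. \<exists>\<phi>. rotates_plane_by R (A j) \<phi>"
    using dec by (simp add: invariant_plane_decomposition_def invariant_plane_def)
  then obtain \<phi> where rot: "\<And>j. j \<in> {1..k} \<Longrightarrow> rotates_plane_by R (A j) (\<phi> j)" by metis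
  then have sA: "subspace (A j)" and dA: "dim (A j) = 2"
      and CA: "\<And>x. x \<in> A j \<Longrightarrow> R x + inv R x = (2 * cos (\<phi> j)) *\<^sub>R x"
    if "j \<in> {1..k}" for j using that by (auto simp: rotates_plane_by_iff)
  have no_eigen: "x = 0" if j: "j \<in> {1..k}" and x: "x \<in> A j" "R x = t *\<^sub>R x" for j x t
  proof (rule ccontr)
    assume "x \<noteq> 0"
    then have "t \<in> real_spectrum R" using x(2) by (auto simp: mem_real_spectrum)
    then have "orthogonal x x"
      using ortho[of "Inl t" "Inr j" x x] j x by (auto simp: mem_eigenspace)
    then show False using \<open>x \<noteq> 0\<close> by (simp add: orthogonal_self)
  qed
  have UA: "?U \<inter> A j = (if A j \<subseteq> \<Theta> then A j else {0})" if "j \<in> {1..k}" for j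
    by (rule core_Int_plane[OF rot[OF that]]) (rule no_eigen[OF that])
  \<comment> \<open>The eigenvalue of \<open>R + inv R\<close> on each component.\<close>
  define l where "l = case_sum (\<lambda>\<mu>. 2 * \<mu>) (\<lambda>j. 2 * cos (\<phi> j))"
  have C_eigen: "R x + inv R x = l i *\<^sub>R x" if "i \<in> ?I" "x \<in> ?S i" for i x
  proof (cases i)
    case (Inl \<mu>)
    then have Rx: "R x = \<mu> *\<^sub>R x" and "\<mu> \<in> {-1, 1}"
      using that real_spectrum_subset by (auto simp: mem_eigenspace)
    then have "R (\<mu> *\<^sub>R x) = x" by (auto simp: linear_cmul[OF linear_R])
    then have "inv R x = \<mu> *\<^sub>R x" by (metis inv_R)
    then show ?thesis using Rx by (simp add: Inl l_def flip: scaleR_add_left)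
  next
    case (Inr j)
    then show ?thesis using that CA by (auto simp: l_def)
  qed
  \<comment> \<open>If the cosine were \<mu>, which is 1 or -1, then
    \<open>R x - \<mu> *\<^sub>R x\<close> would have norm 0 for \<open>x\<close> in the plane,
    which would give the plane an eigenvector.\<close>
  have cos_ne: "cos (\<phi> j) \<noteq> \<mu>" if j: "j \<in> {1..k}" and \<mu>: "\<mu> \<in> real_spectrum R" for j \<mu>
  proof
    assume eq: "cos (\<phi> j) = \<mu>"
    have "\<not> A j \<subseteq> {0}" using dA[OF j] dim_eq_0[of "A j"] by simp
    then obtain x where x: "x \<in> A j" "x \<noteq> 0" by blast
    have "2 * (x \<bullet> R x) = 2 * \<mu> * (x \<bullet> x)"
      using arg_cong[OF CA[OF j x(1)], of "\<lambda>y. x \<bullet> y"] eq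
      by (simp add: inner_add_right inner_inv_right inner_commute)
    moreover have "\<mu> * \<mu> = 1" using \<mu> real_spectrum_subset by auto
    ultimately have "(R x - \<mu> *\<^sub>R x) \<bullet> (R x - \<mu> *\<^sub>R x) = 0"
      by (simp add: inner_diff_left inner_diff_right inner_R inner_commute flip: mult.assoc)
    then show False using no_eigen[OF j x(1), of \<mu>] x(2) by simp
  qed
  \<comment> \<open>Planes inside \<Theta> are left out, since they may share an eigenvalue with
    other planes.\<close>
  have inj: "inj_on l (?I - Inr ` ?K)"
  proof (rule inj_onI)
    fix a b assume a: "a \<in> ?I - Inr ` ?K" and b: "b \<in> ?I - Inr ` ?K" and l: "l a = l b"
    show "a = b"
    proof (cases a; cases b)
      fix i j assume [simp]: "a = Inr i" "b = Inr j"
      have ij: "i \<in> {1..k}" "j \<in> {1..k}" "\<not> A i \<subseteq> \<Theta>" "\<not> A j \<subseteq> \<Theta>" using a b by auto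
      have "cos (\<phi> i) = cos (\<phi> j)" using l by (simp add: l_def)
      \<comment> \<open>The chosen angles may differ, for instance in sign, but equal cosines make
        \<open>\<phi> i\<close> an angle of both planes, as \<open>adapted_planes\<close>
        requires.\<close>
      then have "rotates_plane_by R (A j) (\<phi> i)"
        using rot[OF ij(2)] by (simp add: rotates_plane_by_iff)
      then show ?thesis
        using adapted[unfolded adapted_planes_def, rule_format, OF ij(1,2), of "\<phi> i"]
          rot[OF ij(1)] ij(3,4) by auto
    next
      fix \<mu> j assume [simp]: "a = Inl \<mu>" "b = Inr j"
      show ?thesis using cos_ne[of j \<mu>] a b l by (auto simp: l_def)
    next
      fix \<mu> j assume [simp]: "a = Inr j" "b = Inl \<mu>"
      show ?thesis using cos_ne[of j \<mu>] a b l by (auto simp: l_def)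
    qed (use l in \<open>auto simp: l_def\<close>)
  qed
  have "?U = span (\<Union>i\<in>?I. ?U \<inter> ?S i)"
  proof
    show "span (\<Union>i\<in>?I. ?U \<inter> ?S i) \<subseteq> ?U" by (rule span_minimal) (use sU in auto)
    show "?U \<subseteq> span (\<Union>i\<in>?I. ?U \<inter> ?S i)"
    proof
      fix u assume u: "u \<in> ?U"
      have "\<exists>!f. f \<in> (\<Pi>\<^sub>E i\<in>?I. ?S i) \<and> u = (\<Sum>i\<in>?I. f i)"
        using od unfolding orthogonal_decomposition_def by (elim conjE) (erule allE)
      then obtain f where f: "f \<in> (\<Pi>\<^sub>E i\<in>?I. ?S i)" "u = (\<Sum>i\<in>?I. f i)"
        by (elim ex1E conjE)
      have fS: "f i \<in> ?S i" if "i \<in> ?I" for i using f(1) that by blast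
      \<comment> \<open>Planes inside \<Theta> lie entirely in the core, so their components can be
        subtracted from \<open>u\<close>; the rest is a sum of eigenvectors for distinct
        eigenvalues.\<close>
      have K: "f i \<in> ?U" if "i \<in> Inr ` ?K" for i
        using that fS[of i] UA by fastforce
      have sub: "Inr ` ?K \<subseteq> ?I" by auto
      have "(\<Sum>i\<in>?I - Inr ` ?K. f i) = u - (\<Sum>i\<in>Inr ` ?K. f i)"
        unfolding f(2) by (rule sum_diff[OF fin sub])
      also have "\<dots> \<in> ?U" by (rule subspace_diff[OF sU u subspace_sum[OF sU K]])
      finally have sum_U: "(\<Sum>i\<in>?I - Inr ` ?K. f i) \<in> ?U" .
      have "f i \<in> ?U" if "i \<in> ?I - Inr ` ?K" for i
      proof (rule subspace_sum_eigenvectors_mem[OF _ _ sU _ inj _ sum_U that])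
        show "linear (\<lambda>x. R x + inv R x)"
          by (rule linear_compose_add[OF linear_R linear_inv])
        show "R x + inv R x \<in> ?U" if "x \<in> ?U" for x
          by (rule subspace_add[OF sU core_R[OF subspace_\<Theta> that] core_inv[OF that]])
        show "R (f i) + inv R (f i) = l i *\<^sub>R f i" if "i \<in> ?I - Inr ` ?K" for i
          using that C_eigen fS by blast
      qed (use fin in simp)
      then have fU: "f i \<in> ?U" if "i \<in> ?I" for i using K that by blast
      show "u \<in> span (\<Union>i\<in>?I. ?U \<inter> ?S i)"
        unfolding f(2)
      proof (rule span_sum)
        fix i assume "i \<in> ?I"
        then have "f i \<in> (\<Union>i\<in>?I. ?U \<inter> ?S i)" using fU fS by blast
        then show "f i \<in> span (\<Union>i\<in>?I. ?U \<inter> ?S i)" by (rule span_base)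
      qed
    qed
  qed
  then have "dim ?U = dim (span (\<Union>i\<in>?I. ?U \<inter> ?S i))" by simp
  also have "\<dots> = (\<Sum>i\<in>?I. dim (?U \<inter> ?S i))"
    by (rule dim_span_orthogonal_family[OF fin]) (use ortho in blast)
  also have "\<dots> = (\<Sum>i\<in>Inl ` real_spectrum R. dim (?U \<inter> ?S i)) + (\<Sum>i\<in>Inr ` {1..k}. dim (?U \<inter> ?S i))"
    by (rule sum.union_disjoint) (use finite_real_spectrum in auto)
  also have "(\<Sum>i\<in>Inl ` real_spectrum R. dim (?U \<inter> ?S i)) =
      (\<Sum>\<mu>\<in>real_spectrum R. dim (\<Theta> \<inter> eigenspace R \<mu>))"
    by (simp add: sum.reindex core_Int_eigenspace)
  also have "(\<Sum>i\<in>Inr ` {1..k}. dim (?U \<inter> ?S i)) = (\<Sum>j\<in>{1..k}. dim (?U \<inter> A j))"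
    by (simp add: sum.reindex)
  also have "\<dots> = (\<Sum>j\<in>{1..k}. if A j \<subseteq> \<Theta> then 2 else 0)"
    by (rule sum.cong) (auto simp: UA dA)
  also have "\<dots> = 2 * card ?K" by (simp add: sum.If_cases Int_def)
  finally show ?thesis by simp
qed

section \<open>Existence of adapted decompositions\<close>

text \<open>Two planes with a common angle contain together a vector \<open>x\<close> with \<open>x\<close> and \<open>R x\<close>
  orthogonal to \<open>z\<close>, and the span of these two vectors is invariant.\<close>

lemma common_angle_meets_core:
  assumes rotA: "rotates_plane_by R A \<phi>" and rotB: "rotates_plane_by R B \<phi>"
    and ortho: "\<And>x y. x \<in> A \<Longrightarrow> y \<in> B \<Longrightarrow> orthogonal x y"
  shows "\<exists>x \<in> core \<Theta> \<inter> span (A \<union> B). x \<noteq> 0"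
proof -
  let ?F = "span (A \<union> B)"
  have A: "dim A = 2" and B: "dim B = 2" using rotA rotB by (auto simp: rotates_plane_by_iff)
  have dF: "dim ?F = 4"
    using dim_orthogonal_sum[of A B] ortho A B by (simp add: orthogonal_def)
  let ?T = "{x. R x \<in> ?F \<and> R x + inv R x = (2 * cos \<phi>) *\<^sub>R x}"
  have "A \<union> B \<subseteq> ?T"
    using rotA rotB by (auto simp: rotates_plane_by_iff intro: span_base)
  then have F: "?F \<subseteq> ?T" by (rule span_minimal) (rule subspace_cosine[OF subspace_span])
  \<comment> \<open>For \<open>x\<close> in \<open>?F\<close>, orthogonality to \<open>p\<close> and
    \<open>p'\<close> amounts to orthogonality of \<open>x\<close> and \<open>R x\<close> to
    \<open>z\<close>. These are two linear conditions on a space of dimension 4, so a nonzero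
    solution exists.\<close>
  obtain p p' where p: "p \<in> ?F" "z - p \<in> ?F\<^sup>\<bottom>" and p': "p' \<in> ?F" "inv R z - p' \<in> ?F\<^sup>\<bottom>"
    using orth_proj_props[OF subspace_span] by blast
  have sub: "span {p, p'} \<subseteq> ?F" using p(1) p'(1) by (intro span_minimal) auto
  have "card {p, p'} \<le> 2" by (simp add: card_insert_if)
  then have "dim {p, p'} \<le> 2" using dim_le_card'[of "{p, p'}"] by simp
  then have "dim (span {p, p'}) \<noteq> dim ?F" unfolding dim_span[of "{p, p'}"] dF by linarith
  then have "span {p, p'} \<noteq> ?F" by (rule contrapos_nn) (rule arg_cong)
  with sub have "span {p, p'} \<subset> ?F" by (rule psubsetI)
  then obtain x where x: "x \<noteq> 0" "x \<in> ?F" "\<And>y. y \<in> span {p, p'} \<Longrightarrow> orthogonal x y"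
    using orthogonal_to_subspace_exists_gen by blast
  have "x \<bullet> p = 0" "x \<bullet> p' = 0" using x(3) by (auto simp: orthogonal_def intro: span_base)
  then have xz: "x \<bullet> z = 0" and Rxz: "R x \<bullet> z = 0"
    using x(2) p(2) p'(2)
    by (auto simp: orthogonal_comp_def orthogonal_def inner_diff_right inner_inv_right)
  have Cx: "R x + inv R x = (2 * cos \<phi>) *\<^sub>R x" using x(2) F by blast
  have "R (R x) + x = (2 * cos \<phi>) *\<^sub>R R x"
    using arg_cong[OF Cx, of R] by (simp add: linear_add[OF linear_R] linear_cmul[OF linear_R])
  then have RR: "R (R x) = (2 * cos \<phi>) *\<^sub>R R x - x" by (simp add: algebra_simps)
  have "span {x, R x} \<subseteq> core \<Theta>"
  proof (rule subset_coreI)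
    have "R x \<in> span {x, R x}" "R (R x) \<in> span {x, R x}"
      unfolding RR by (auto intro!: span_diff span_scale intro: span_base)
    then have "{x, R x} \<subseteq> R -` span {x, R x}" by simp
    then have "span {x, R x} \<subseteq> R -` span {x, R x}"
      by (rule span_minimal) (rule linear_subspace_vimage[OF linear_R subspace_span])
    then show "R y \<in> span {x, R x}" if "y \<in> span {x, R x}" for y using that by blast
    show "span {x, R x} \<subseteq> \<Theta>"
      by (rule span_minimal) (use xz Rxz subspace_\<Theta> in \<open>auto simp: mem_\<Theta>\<close>)
  qed simp
  then have "x \<in> core \<Theta>" by (auto intro: span_base)
  then show ?thesis using x by blast
qed

text \<open>Planes taken from \<open>?U\<close> lie in \<Theta>. Two planes of \<open>?V\<close>
  sharing an angle would together contain a nonzero vector of the core, which would then belong to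
  both \<open>?U\<close> and its orthogonal complement.\<close>

lemma ex_adapted_family:
  assumes sE: "subspace E" and RE: "\<And>x. x \<in> E \<Longrightarrow> R x \<in> E"
    and no_eigen: "\<And>x t. x \<in> E \<Longrightarrow> R x = t *\<^sub>R x \<Longrightarrow> x = 0"
  shows "\<exists>\<A>. orthogonal_planes \<A> E \<and>
    (\<forall>A\<in>\<A>. \<forall>B\<in>\<A>. \<forall>\<phi>. A \<noteq> B \<and> rotates_plane_by R A \<phi> \<and> rotates_plane_by R B \<phi>
      \<longrightarrow> A \<subseteq> \<Theta> \<or> B \<subseteq> \<Theta>)"
proof -
  let ?U = "core \<Theta> \<inter> E"
  let ?V = "E \<inter> ?U\<^sup>\<bottom>"
  have sU: "subspace ?U" by (intro subspace_inter subspace_core subspace_\<Theta> sE)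
  have RU: "R x \<in> ?U" if "x \<in> ?U" for x using that core_R[OF subspace_\<Theta>] RE by blast
  have sV: "subspace ?V" by (intro subspace_inter sE subspace_orthogonal_comp)
  have RV: "R x \<in> ?V" if "x \<in> ?V" for x
    using that RE invariant_orthogonal_comp[OF sU RU] by blast
  have "\<exists>\<A>. orthogonal_planes \<A> ?U"
    by (rule ex_plane_decomposition[OF sU]) (use RU no_eigen in blast)+
  then obtain \<A> where "orthogonal_planes \<A> ?U" by blast
  note \<A> = orthogonal_planesD[OF this]
  have "\<exists>\<A>. orthogonal_planes \<A> ?V"
    by (rule ex_plane_decomposition[OF sV]) (use RV no_eigen in blast)+
  then obtain \<B> where "orthogonal_planes \<B> ?V" by blast
  note \<B> = orthogonal_planesD[OF this]
  note AU = \<A>(5) and BV = \<B>(5)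
  have UV: "orthogonal x y" "orthogonal y x" if "x \<in> ?U" "y \<in> ?V" for x y
    using that by (auto simp: orthogonal_comp_def orthogonal_commute)
  have po: "orthogonal x y"
    if AB: "A \<in> \<A> \<union> \<B>" "B \<in> \<A> \<union> \<B>" and "A \<noteq> B" "x \<in> A" "y \<in> B" for A B x y
  proof -
    consider "A \<in> \<A>" "B \<in> \<A>" | "A \<in> \<B>" "B \<in> \<B>" | "A \<in> \<A>" "B \<in> \<B>" | "A \<in> \<B>" "B \<in> \<A>"
      using AB by blast
    then show ?thesis
    proof cases
      case 1
      then show ?thesis using \<A>(3) that(3-5) by blast
    next
      case 2
      then show ?thesis using \<B>(3) that(3-5) by blast
    next
      case 3
      then show ?thesis using UV(1)[of x y] AU[of A] BV[of B] that(4,5) by blast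
    next
      case 4
      then show ?thesis using UV(2)[of y x] BV[of A] AU[of B] that(4,5) by blast
    qed
  qed
  have "span (\<Union>(\<A> \<union> \<B>)) = E"
  proof
    show "span (\<Union>(\<A> \<union> \<B>)) \<subseteq> E" using AU BV sE by (intro span_minimal) auto
    show "E \<subseteq> span (\<Union>(\<A> \<union> \<B>))"
    proof
      fix x assume x: "x \<in> E"
      obtain u v where uv: "u \<in> ?U" "v \<in> ?U\<^sup>\<bottom>" "x = u + v"
        using subspace_sum_orthogonal_comp[OF sU] by (metis UNIV_I set_plus_elim)
      have "x - u \<in> E" using subspace_diff[OF sE x] uv(1) by blast
      then have "v \<in> ?V" using uv by simp
      then have "v \<in> span (\<Union>(\<A> \<union> \<B>))"
        using \<B>(4) span_mono[of "\<Union>\<B>" "\<Union>(\<A> \<union> \<B>)"] by auto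
      moreover have "u \<in> span (\<Union>(\<A> \<union> \<B>))"
        using uv(1) \<A>(4) span_mono[of "\<Union>\<A>" "\<Union>(\<A> \<union> \<B>)"] by auto
      ultimately show "x \<in> span (\<Union>(\<A> \<union> \<B>))" unfolding uv(3) by (intro span_add)
    qed
  qed
  then have planes: "orthogonal_planes (\<A> \<union> \<B>) E"
    unfolding orthogonal_planes_def using \<A>(1,2) \<B>(1,2) po by (intro conjI ballI impI) auto
  have adapted: "A \<subseteq> \<Theta> \<or> B \<subseteq> \<Theta>"
    if AB: "A \<in> \<A> \<union> \<B>" "B \<in> \<A> \<union> \<B>" "A \<noteq> B"
      and rot: "rotates_plane_by R A \<phi>" "rotates_plane_by R B \<phi>" for A B \<phi>
  proof (rule ccontr)
    assume "\<not> (A \<subseteq> \<Theta> \<or> B \<subseteq> \<Theta>)"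
    then have "A \<in> \<B>" "B \<in> \<B>" using AB AU core_subset by blast+
    then have "span (A \<union> B) \<subseteq> ?V" using BV sV by (intro span_minimal) auto
    moreover obtain x where "x \<in> core \<Theta> \<inter> span (A \<union> B)" "x \<noteq> 0"
      using common_angle_meets_core[OF rot] po[OF AB] by blast
    ultimately show False using UV(1)[of x x] by (auto simp: orthogonal_self)
  qed
  show ?thesis
    by (intro exI[of _ "\<A> \<union> \<B>"] conjI planes ballI allI impI) (elim conjE, rule adapted)
qed

text \<open>The orthogonal complement of the sum \<open>G\<close> of the eigenspaces is invariant
  and contains no eigenvectors, so it splits into an adapted family of planes.\<close>

lemma ex_adapted_decomposition:
  "\<exists>k A. invariant_plane_decomposition R k A \<and> adapted_planes R \<Theta> k A"
proof -
  let ?\<sigma> = "real_spectrum R"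
  define G where "G = span (\<Union>\<mu>\<in>?\<sigma>. eigenspace R \<mu>)"
  have sG: "subspace G" by (simp add: G_def)
  have RG: "R x \<in> G" if "x \<in> G" for x
  proof -
    have "R y \<in> G" if "\<mu> \<in> ?\<sigma>" "y \<in> eigenspace R \<mu>" for y \<mu>
    proof -
      have "y \<in> G" using that unfolding G_def by (blast intro: span_base)
      then show ?thesis using that(2) sG by (simp add: mem_eigenspace subspace_scale)
    qed
    then have "(\<Union>\<mu>\<in>?\<sigma>. eigenspace R \<mu>) \<subseteq> R -` G" by blast
    then have "G \<subseteq> R -` G"
      unfolding G_def by (rule span_minimal) (rule linear_subspace_vimage[OF linear_R subspace_span])
    then show ?thesis using that by blast
  qed
  have G_eigen: "eigenspace R \<mu> \<subseteq> G" if "\<mu> \<in> ?\<sigma>" for \<mu>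
    using that unfolding G_def by (blast intro: span_base)
  have no_eigen: "x = 0" if "x \<in> G\<^sup>\<bottom>" "R x = t *\<^sub>R x" for x t
  proof (rule ccontr)
    assume "x \<noteq> 0"
    then have "t \<in> ?\<sigma>" using that(2) by (auto simp: mem_real_spectrum)
    then have "x \<in> G" using G_eigen[of t] that(2) mem_eigenspace by blast
    then have "orthogonal x x" using that(1) by (auto simp: orthogonal_comp_def)
    then show False using \<open>x \<noteq> 0\<close> by (simp add: orthogonal_self)
  qed
  have "\<exists>\<A>. orthogonal_planes \<A> (G\<^sup>\<bottom>) \<and>
    (\<forall>A\<in>\<A>. \<forall>B\<in>\<A>. \<forall>\<phi>. A \<noteq> B \<and> rotates_plane_by R A \<phi> \<and> rotates_plane_by R B \<phi>
      \<longrightarrow> A \<subseteq> \<Theta> \<or> B \<subseteq> \<Theta>)"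
  proof (rule ex_adapted_family)
    show "subspace (G\<^sup>\<bottom>)" by (rule subspace_orthogonal_comp)
    show "R x \<in> G\<^sup>\<bottom>" if "x \<in> G\<^sup>\<bottom>" for x
      by (rule invariant_orthogonal_comp[OF sG RG that])
  qed (fact no_eigen)
  then obtain \<A> where planes: "orthogonal_planes \<A> (G\<^sup>\<bottom>)"
    and ad: "\<forall>A\<in>\<A>. \<forall>B\<in>\<A>. \<forall>\<phi>. A \<noteq> B \<and> rotates_plane_by R A \<phi> \<and> rotates_plane_by R B \<phi>
      \<longrightarrow> A \<subseteq> \<Theta> \<or> B \<subseteq> \<Theta>"
    by blast
  note fin = orthogonal_planesD(1)[OF planes] and pl = orthogonal_planesD(2)[OF planes]
    and po = orthogonal_planesD(3)[OF planes] and sp = orthogonal_planesD(4)[OF planes]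
  define k where "k = card \<A>"
  obtain A where bij: "bij_betw A {1..k} \<A>"
    using ex_bij_betw_nat_finite_1[OF fin] by (auto simp: k_def)
  have A: "A j \<in> \<A>" if "j \<in> {1..k}" for j using bij that by (auto simp: bij_betw_def)
  have A_neq: "A i \<noteq> A j" if "i \<in> {1..k}" "j \<in> {1..k}" "i \<noteq> j" for i j
    using inj_on_eq_iff[OF bij_betw_imp_inj_on[OF bij] that(1,2)] that(3) by simp
  have UA: "(\<Union>j\<in>{1..k}. A j) = \<Union>\<A>" using bij by (simp add: bij_betw_def)
  have plane: "subspace (A j)" "dim (A j) = 2" if "j \<in> {1..k}" for j
    using pl A[OF that] by (auto simp: invariant_plane_def rotates_plane_by_def)
  have AA: "orthogonal x y"
    if "i \<in> {1..k}" "j \<in> {1..k}" "i \<noteq> j" "x \<in> A i" "y \<in> A j" for i j x y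
    using po A[OF that(1)] A[OF that(2)] A_neq[OF that(1-3)] that(4,5) by blast
  have AG: "A j \<subseteq> G\<^sup>\<bottom>" if "j \<in> {1..k}" for j
    using A[OF that] by (rule orthogonal_planesD(5)[OF planes])
  \<comment> \<open>Counting dimensions of the pairwise orthogonal planes gives the bound on
    \<open>k\<close>.\<close>
  have "2 * k = (\<Sum>j\<in>{1..k}. dim (A j))" using plane(2) by simp
  also have "\<dots> = dim (span (\<Union>j\<in>{1..k}. A j))"
    by (rule dim_span_orthogonal_family[symmetric]) (use AA in auto)
  also have "\<dots> \<le> DIM('a)" by (rule dim_subset_UNIV)
  finally have k: "real k \<le> real DIM('a) / 2" by linarith
  let ?I = "Inl ` ?\<sigma> \<union> Inr ` {1..k}" and ?S = "case_sum (eigenspace R) A"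
  have "orthogonal_decomposition ?I ?S"
  proof (rule orthogonal_decompositionI)
    show "finite ?I" using finite_real_spectrum by simp
    show "subspace (?S i)" if "i \<in> ?I" for i
      using that subspace_eigenspace plane(1) by auto
    fix i j x y assume ij: "i \<in> ?I" "j \<in> ?I" "i \<noteq> j" and xy: "x \<in> ?S i" "y \<in> ?S j"
    have GA: "orthogonal a b \<and> orthogonal b a"
      if "\<mu> \<in> ?\<sigma>" "m \<in> {1..k}" "a \<in> eigenspace R \<mu>" "b \<in> A m" for \<mu> m a b
    proof -
      have "a \<in> G" "b \<in> G\<^sup>\<bottom>" using G_eigen[OF that(1)] AG[OF that(2)] that(3,4) by blast+
      then have "orthogonal a b" by (simp add: orthogonal_comp_def)
      then show ?thesis by (simp add: orthogonal_commute)
    qed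
    show "orthogonal x y"
      using ij xy orthogonal_eigenspaces AA GA by (cases i; cases j) auto
  next
    have "x \<in> span (\<Union>i\<in>?I. ?S i)" for x
    proof -
      obtain g e where ge: "g \<in> G" "e \<in> G\<^sup>\<bottom>" "x = g + e"
        using subspace_sum_orthogonal_comp[OF sG] by (metis UNIV_I set_plus_elim)
      have un: "(\<Union>i\<in>?I. ?S i) = (\<Union>\<mu>\<in>?\<sigma>. eigenspace R \<mu>) \<union> \<Union>\<A>"
        unfolding UA[symmetric] by auto
      have "g \<in> span (\<Union>i\<in>?I. ?S i)" "e \<in> span (\<Union>i\<in>?I. ?S i)"
        unfolding un
        using ge(1,2) span_mono[of "\<Union>\<mu>\<in>?\<sigma>. eigenspace R \<mu>" "(\<Union>\<mu>\<in>?\<sigma>. eigenspace R \<mu>) \<union> \<Union>\<A>"]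
          span_mono[of "\<Union>\<A>" "(\<Union>\<mu>\<in>?\<sigma>. eigenspace R \<mu>) \<union> \<Union>\<A>"]
        by (auto simp: G_def sp)
      then show ?thesis unfolding ge(3) by (rule span_add)
    qed
    then show "span (\<Union>i\<in>?I. ?S i) = UNIV" by blast
  qed
  then have "invariant_plane_decomposition R k A"
    using k pl A by (simp add: invariant_plane_decomposition_def)
  moreover have "adapted_planes R \<Theta> k A"
    unfolding adapted_planes_def
  proof (intro ballI allI impI)
    fix i j \<phi>
    assume ij: "i \<in> {1..k}" "j \<in> {1..k}"
      and rot: "i \<noteq> j \<and> rotates_plane_by R (A i) \<phi> \<and> rotates_plane_by R (A j) \<phi>"
    then have "A i \<noteq> A j" using A_neq by simp
    then show "A i \<subseteq> \<Theta> \<or> A j \<subseteq> \<Theta>"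
      using ad[rule_format, OF A[OF ij(1)] A[OF ij(2)], of \<phi>] rot by simp
  qed
  ultimately show ?thesis by blast
qed

end

text \<open>The second conjunct ensures that the first is not vacuous. Since the sum is governed by
  \<open>core \<Theta>\<close> alone, all adapted decompositions have the same number of planes
  inside \<Theta>.\<close>

theorem theorem3:
  fixes R P :: "real ^ 'd \<Rightarrow> real ^ 'd" and z :: "real ^ 'd" and \<Theta> :: "(real ^ 'd) set"
  assumes "orthogonal_transformation R"
    and "norm z = 1"
    and "\<Theta> = {z}\<^sup>\<bottom>"
    and "P = orth_proj \<Theta>"
  shows "(\<forall>k A. invariant_plane_decomposition R k A \<and> adapted_planes R \<Theta> k A \<longrightarrow>
            (\<lambda>n. (norm (((P \<circ> R) ^^ n) z))\<^sup>2) sums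
              (real CARD('d) - (\<Sum>\<mu>\<in>real_spectrum R. real (dim (\<Theta> \<inter> eigenspace R \<mu>)))
                 - 2 * real (card {j\<in>{1..k}. A j \<subseteq> \<Theta>})))
       \<and> (\<exists>k A. invariant_plane_decomposition R k A \<and> adapted_planes R \<Theta> k A)"
proof -
  interpret observed_orthogonal_operator R P z \<Theta>
    by unfold_locales (fact assms)+
  show ?thesis
  proof (intro conjI allI impI ex_adapted_decomposition)
    fix k A assume *: "invariant_plane_decomposition R k A \<and> adapted_planes R \<Theta> k A"
    have "real DIM(real ^ 'd) - real (dim (core \<Theta>)) =
        real CARD('d) - (\<Sum>\<mu>\<in>real_spectrum R. real (dim (\<Theta> \<inter> eigenspace R \<mu>)))
          - 2 * real (card {j\<in>{1..k}. A j \<subseteq> \<Theta>})"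
      using dim_core[of k A] * by simp
    then show "(\<lambda>n. (norm (((P \<circ> R) ^^ n) z))\<^sup>2) sums
        (real CARD('d) - (\<Sum>\<mu>\<in>real_spectrum R. real (dim (\<Theta> \<inter> eigenspace R \<mu>)))
          - 2 * real (card {j\<in>{1..k}. A j \<subseteq> \<Theta>}))"
      using sums_dim_core by (simp only:)
  qed
qed

end
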